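(* Let $M>0$, $|a|\le M$, and let $(\alpha,\underline\alpha,\rho,\sigma)$ be a smooth solution of the Maxwell equations (stated in the context) on the Kerr exterior relative to the algebraically special frame. Define $$\widehat\rho=\tfrac14\Sigma[(\mathrm{tr}\underline\chi)^2-(\varepsilon\cdot\underline\chi)^2]\,\Sigma\rho+\tfrac12\Sigma(\varepsilon\cdot\underline\chi)(\mathrm{tr}\underline\chi)\,\Sigma\sigma,\qquad \widehat\sigma=-\tfrac12\Sigma(\varepsilon\cdot\underline\chi)(\mathrm{tr}\underline\chi)\,\Sigma\rho+\tfrac14\Sigma[(\mathrm{tr}\underline\chi)^2-(\varepsilon\cdot\underline\chi)^2]\,\Sigma\sigma,$$ i.e. $\widehat\rho=(r^2-a^2\cos^2\theta)\rho-2ar\cos\theta\,\sigma$ and $\widehat\sigma=2ar\cos\theta\,\rho+(r^2-a^2\cos^2\theta)\sigma$. Then $$D_3\widehat\sigma=\tfrac12\Sigma^2(\varepsilon\cdot\underline\chi)(\mathrm{tr}\underline\chi)\,\mathrm{div}\,\underline\alpha-\tfrac14\Sigma^2[(\mathrm{tr}\underline\chi)^2-(\varepsilon\cdot\underline\chi)^2]\,\mathrm{curl}\,\underline\alpha,$$ $$D_3\widehat\rho=-\tfrac14\Sigma^2[(\mathrm{tr}\underline\chi)^2-(\varepsilon\cdot\underline\chi)^2]\,\mathrm{div}\,\underline\alpha-\tfrac12\Sigma^2(\varepsilon\cdot\underline\chi)(\mathrm{tr}\underline\chi)\,\mathrm{curl}\,\underline\alpha,$$ $$D_4\widehat\sigma=-\tfrac12\Sigma(\varepsilon\cdot\underline\chi)(\mathrm{tr}\underline\chi)\,\mathrm{div}(\Sigma\alpha)-\tfrac14\Sigma[(\mathrm{tr}\underline\chi)^2-(\varepsilon\cdot\underline\chi)^2]\,\mathrm{curl}(\Sigma\alpha),$$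 $$D_4\widehat\rho=\tfrac14\Sigma[(\mathrm{tr}\underline\chi)^2-(\varepsilon\cdot\underline\chi)^2]\,\mathrm{div}(\Sigma\alpha)-\tfrac12\Sigma(\varepsilon\cdot\underline\chi)(\mathrm{tr}\underline\chi)\,\mathrm{curl}(\Sigma\alpha),$$ $$D\widehat\sigma=-\tfrac12\Sigma(\varepsilon\cdot\underline\chi)(\mathrm{tr}\underline\chi)\,(\mathfrak T(\alpha)-\underline{\mathfrak T}(\underline\alpha))-\tfrac14\Sigma[(\mathrm{tr}\underline\chi)^2-(\varepsilon\cdot\underline\chi)^2]\,({}^\star\mathfrak T(\alpha)+{}^\star\underline{\mathfrak T}(\underline\alpha)),$$ $$D\widehat\rho=\tfrac14\Sigma[(\mathrm{tr}\underline\chi)^2-(\varepsilon\cdot\underline\chi)^2]\,(\mathfrak T(\alpha)-\underline{\mathfrak T}(\underline\alpha))-\tfrac12\Sigma(\varepsilon\cdot\underline\chi)(\mathrm{tr}\underline\chi)\,({}^\star\mathfrak T(\alpha)+{}^\star\underline{\mathfrak T}(\underline\alpha)),$$ where $\mathfrak T(\alpha)=\frac12\Sigma(D_3\alpha+\underline\chi\cdot\alpha)$ and $\underline{\mathfrak T}(\underline\alpha)=\frac12\Sigma(D_4\underline\alpha+\chi\cdot\underline\alpha+\hat\omega\,\underline\alpha)$.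
   Context: Kerr exterior. For $M>0$, $|a|\le M$ let $r_\pm=M\pm\sqrt{M^2-a^2}$, $\Delta=(r-r_+)(r-r_-)$, $\Sigma=r^2+a^2\cos^2\theta$. $(\mathcal M,g)$ is $\mathbb R_{\bar t}\times[r_+,\infty)_r\times\mathbb S^2_{(\theta,\bar\phi)}$ with $g=-(1-\frac{2Mr}{\Sigma})d\bar t^2+2d\bar t\,dr+\Sigma d\theta^2+\frac{(r^2+a^2)^2-\Delta a^2\sin^2\theta}{\Sigma}\sin^2\theta\,d\bar\phi^2-2a\sin^2\theta\,dr\,d\bar\phi-\frac{4aMr}{\Sigma}\sin^2\theta\,d\bar t\,d\bar\phi$. Boyer–Lindquist coordinates $(t,r,\theta,\phi)$ on $r>r_+$ are given (with $r_0=9M/4$) by $\bar t=t+\int_{r_0}^r\frac{s^2+a^2}{\Delta(s)}ds$, $\bar\phi=\phi+\int_{r_0}^r\frac{a}{\Delta(s)}ds$. Algebraically special frame and horizontal calculus. $e_4=\frac{r^2+a^2}{\Sigma}\partial_t+\frac{\Delta}{\Sigma}\partial_r+\frac a\Sigma\partial_\phi$, $e_3=\frac{r^2+a^2}{\Delta}\partial_t-\partial_r+\frac a\Delta\partial_\phi$ (Boyer–Lindquist; both extend smoothly to $r=r_+$), $e_1=\frac{a^2\sin\theta\cos\theta}{\Sigma}\partial_t+\frac r\Sigma\partial_\theta+\frac{a\cos\theta}{\Sigma\sin\theta}\partial_\phi$, $e_2=\frac{ar\sin\theta}{\Sigma}\partial_t-\frac{a\cos\theta}{\Sigma}\partial_\theta+\frac{r}{\Sigma\sin\theta}\partial_\phi$.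 $\mathfrak D=\langle e_3,e_4\rangle^\perp$ is the horizontal distribution, with orthonormal frame $(e_1,e_2)$; $\gamma=g|_{\mathfrak D}$, $\varepsilon$ its area form with $\varepsilon(e_1,e_2)=1$. $\mathfrak D$ one-forms are sections of $\mathfrak D^*$ (identified with spacetime one-forms vanishing on $e_3,e_4$). $D$ is the connection on $\mathfrak D$ obtained by orthogonally projecting to $\mathfrak D$ the Levi-Civita connection $\nabla$ of $g$: $(D_X\varsigma)(Y)=X(\varsigma(Y))-\varsigma(\Pi_{\mathfrak D}\nabla_XY)$; $D_3=D_{e_3}$, $D_4=D_{e_4}$, $D$ without index is differentiation in $\mathfrak D$-directions (for functions $Du=du|_{\mathfrak D}$). $\mathrm{div}\,\varsigma=\gamma^{AB}(D_A\varsigma)_B$, $\mathrm{curl}\,\varsigma=\varepsilon^{AB}(D_A\varsigma)_B$, $({}^\star\varsigma)_A=\varepsilon_A{}^B\varsigma_B$, $(\varsigma,\tilde\varsigma)=\gamma^{AB}\varsigma_A\tilde\varsigma_B$, $\varsigma\wedge\tilde\varsigma=\varepsilon^{AB}\varsigma_A\tilde\varsigma_B$. Connection coefficients: $\mathrm{tr}\chi=\frac{2r\Delta}{\Sigma^2}$, $(\varepsilon\cdot\chi)=\frac{2a\Delta\cos\theta}{\Sigma^2}$, $\mathrm{tr}\underline\chi=-\frac{2r}\Sigma$, $(\varepsilon\cdot\underline\chi)=\frac{2a\cos\theta}{\Sigma}$, $\hat\omega=-\frac{2(a^2(M-r)\cos^2\theta+a^2r-Mr^2)}{\Sigma^2}$;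 $\chi\cdot\varsigma=\frac12\mathrm{tr}\chi\,\varsigma+\frac12(\varepsilon\cdot\chi){}^\star\varsigma$, $\underline\chi\cdot\varsigma=\frac12\mathrm{tr}\underline\chi\,\varsigma+\frac12(\varepsilon\cdot\underline\chi){}^\star\varsigma$; in Boyer–Lindquist coordinates $\eta=-\frac{a^2r}{\Sigma^2}\sin^2\theta\,dt-\frac{a^2\sin2\theta}{2\Sigma}d\theta+\frac{ar(r^2+a^2)}{\Sigma^2}\sin^2\theta\,d\phi$, $\underline\eta=\frac{a^2r}{\Sigma^2}\sin^2\theta\,dt-\frac{a^2\sin2\theta}{2\Sigma}d\theta-\frac{ar(r^2+a^2)}{\Sigma^2}\sin^2\theta\,d\phi$. Maxwell equations. For a two-form $F$ with $dF=0$, $d\star F=0$, set $\alpha(e_A)=F(e_A,e_4)$, $\underline\alpha(e_A)=F(e_A,e_3)$ ($A=1,2$), $\rho=\frac12F(e_3,e_4)$, $\sigma=\frac12\varepsilon^{AB}F(e_A,e_B)$. In terms of these the Maxwell equations are $D_3\sigma+\mathrm{tr}\underline\chi\,\sigma=-\mathrm{curl}\,\underline\alpha-(\varepsilon\cdot\underline\chi)\rho$, $D_3\rho+\mathrm{tr}\underline\chi\,\rho=-\mathrm{div}\,\underline\alpha+(\varepsilon\cdot\underline\chi)\sigma$, $D_4\sigma+\mathrm{tr}\chi\,\sigma=-\mathrm{curl}\,\alpha-(\eta+\underline\eta)\wedge\alpha+(\varepsilon\cdot\chi)\rho$, $D_4\rho+\mathrm{tr}\chi\,\rho=\mathrm{div}\,\alpha+(\eta+\underline\eta,\alpha)-(\varepsilon\cdot\chi)\sigma$,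 $D_3\alpha+\underline\chi\cdot\alpha=D\rho+{}^\star D\sigma+2\eta\rho+2{}^\star\eta\,\sigma$, $D_4\underline\alpha+\chi\cdot\underline\alpha+\hat\omega\,\underline\alpha=-D\rho+{}^\star D\sigma-2\underline\eta\rho+2{}^\star\underline\eta\,\sigma$. *)

theory Defs
  imports "HOL-Analysis.Analysis"
begin

section \<open>The Kerr exterior\<close>

text \<open>
  The manifold $R \times [r_+,\infty) \times S^2$ is realised in one global chart: the point with
  ingoing coordinates \<open>(t, r, \<omega>)\<close> is \<open>(t, r \<omega>)\<close> in \<open>real \<times> real^3\<close>.  As \<open>r\<^sub>+ > 0\<close> this is a
  diffeomorphism onto the closed set \<open>kerr_ext M a\<close>, which contains the event horizon
  (its boundary) and the axis.  Vectors and covectors at a point are taken in this chart, so that a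
  tangent vector is an element of \<open>real \<times> real^3\<close> and a one-form is a function of a point and a
  vector.  The first component of a point is the ingoing time, not the Boyer--Lindquist one.
\<close>

type_synonym pt = "real \<times> (real^3)"
type_synonym vfield = "pt \<Rightarrow> pt"
type_synonym form1 = "pt \<Rightarrow> pt \<Rightarrow> real"

definition r_plus :: "real \<Rightarrow> real \<Rightarrow> real" where
  "r_plus M a = M + sqrt (M\<^sup>2 - a\<^sup>2)"

definition r_minus :: "real \<Rightarrow> real \<Rightarrow> real" where
  "r_minus M a = M - sqrt (M\<^sup>2 - a\<^sup>2)"

definition rad :: "pt \<Rightarrow> real" where
  "rad p = norm (snd p)"

definition theta :: "pt \<Rightarrow> real" where
  "theta p = arccos (snd p $ 3 / rad p)"

text \<open>On the axis \<open>Arg 0 = 0\<close> selects the value \<open>0\<close> for the azimuth.\<close>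

definition phi :: "pt \<Rightarrow> real" where
  "phi p = Arg (Complex (snd p $ 1) (snd p $ 2))"

definition kerr_ext :: "real \<Rightarrow> real \<Rightarrow> pt set" where
  "kerr_ext M a = {p. r_plus M a \<le> rad p}"

definition kDelta :: "real \<Rightarrow> real \<Rightarrow> pt \<Rightarrow> real" where
  "kDelta M a p = (rad p - r_plus M a) * (rad p - r_minus M a)"

definition kSigma :: "real \<Rightarrow> pt \<Rightarrow> real" where
  "kSigma a p = (rad p)\<^sup>2 + a\<^sup>2 * (cos (theta p))\<^sup>2"

text \<open>
  Coordinate vector fields and covectors of the ingoing coordinates.  The azimuthal direction enters
  as \<open>v_phis\<close>, that is $(1/\sin\theta)\,\partial_\phi$, and dually as \<open>d_phis\<close>, that is
  $\sin\theta\,d\phi$, because these stay of unit size at the axis.  There the pair of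
  $\theta$- and $\phi$-directions depends on the choice \<open>phi p = 0\<close>, but only up to a rotation,
  to which the metric and all the frame contractions below are insensitive.
\<close>

definition sph :: "real \<Rightarrow> real \<Rightarrow> real^3" where
  "sph th ph = vector [sin th * cos ph, sin th * sin ph, cos th]"

definition sph_th :: "real \<Rightarrow> real \<Rightarrow> real^3" where
  "sph_th th ph = vector [cos th * cos ph, cos th * sin ph, - sin th]"

definition sph_ph :: "real \<Rightarrow> real^3" where
  "sph_ph ph = vector [- sin ph, cos ph, 0]"

definition v_t :: vfield where
  "v_t p = (1, 0)"

definition v_r :: vfield where
  "v_r p = (0, sph (theta p) (phi p))"

definition v_th :: vfield where
  "v_th p = (0, rad p *\<^sub>R sph_th (theta p) (phi p))"

definition v_phis :: vfield where
  "v_phis p = (0, rad p *\<^sub>R sph_ph (phi p))"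

definition v_phi :: vfield where
  "v_phi p = sin (theta p) *\<^sub>R v_phis p"

definition d_t :: form1 where
  "d_t p v = fst v"

definition d_r :: form1 where
  "d_r p v = sph (theta p) (phi p) \<bullet> snd v"

definition d_th :: form1 where
  "d_th p v = (sph_th (theta p) (phi p) \<bullet> snd v) / rad p"

definition d_phis :: form1 where
  "d_phis p v = (sph_ph (phi p) \<bullet> snd v) / rad p"

definition kerr_metric :: "real \<Rightarrow> real \<Rightarrow> pt \<Rightarrow> pt \<Rightarrow> pt \<Rightarrow> real" where
  "kerr_metric M a p u v =
     - (1 - 2 * M * rad p / kSigma a p) * (d_t p u * d_t p v)
     + (d_t p u * d_r p v + d_r p u * d_t p v)
     + kSigma a p * (d_th p u * d_th p v)
     + (((rad p)\<^sup>2 + a\<^sup>2)\<^sup>2 - kDelta M a p * a\<^sup>2 * (sin (theta p))\<^sup>2) / kSigma a p * (d_phis p u * d_phis p v)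
     - a * sin (theta p) * (d_r p u * d_phis p v + d_phis p u * d_r p v)
     - 2 * a * M * rad p / kSigma a p * sin (theta p) * (d_t p u * d_phis p v + d_phis p u * d_t p v)"


section \<open>Smoothness, directional derivatives, Levi-Civita connection\<close>

primrec Ck_on :: "nat \<Rightarrow> pt set \<Rightarrow> (pt \<Rightarrow> real) \<Rightarrow> bool" where
  "Ck_on 0 U f \<longleftrightarrow> continuous_on U f"
| "Ck_on (Suc k) U f \<longleftrightarrow> f differentiable_on U \<and>
     (\<forall>b\<in>Basis. Ck_on k U (\<lambda>p. frechet_derivative f (at p) b))"

text \<open>
  Smoothness up to and including the horizon, in the usual sense for manifolds with boundary:
  existence of a smooth extension to an open neighbourhood in the chart.
\<close>

definition smooth_fun :: "real \<Rightarrow> real \<Rightarrow> (pt \<Rightarrow> real) \<Rightarrow> bool" where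
  "smooth_fun M a f \<longleftrightarrow>
     (\<exists>U h. open U \<and> kerr_ext M a \<subseteq> U \<and> (\<forall>k. Ck_on k U h) \<and> (\<forall>p\<in>kerr_ext M a. h p = f p))"

definition smooth_form1 :: "real \<Rightarrow> real \<Rightarrow> form1 \<Rightarrow> bool" where
  "smooth_form1 M a \<omega> \<longleftrightarrow>
     (\<forall>p\<in>kerr_ext M a. linear (\<omega> p)) \<and> (\<forall>v. smooth_fun M a (\<lambda>p. \<omega> p v))"

text \<open>
  The derivative is taken within the exterior (one-sided at the horizon), so only the values of a
  field on the exterior matter.
\<close>

definition dird :: "real \<Rightarrow> real \<Rightarrow> (pt \<Rightarrow> 'b::real_normed_vector) \<Rightarrow> pt \<Rightarrow> pt \<Rightarrow> 'b" where
  "dird M a f p x = frechet_derivative f (at p within kerr_ext M a) x"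

text \<open>
  Koszul's formula for vector fields constant in the chart:
  \<open>christoffel M a p u v\<close> is the covariant derivative at \<open>p\<close> of the constant field \<open>v\<close> along \<open>u\<close>.
\<close>

definition christoffel :: "real \<Rightarrow> real \<Rightarrow> pt \<Rightarrow> pt \<Rightarrow> pt \<Rightarrow> pt" where
  "christoffel M a p u v = (THE z. \<forall>w. 2 * kerr_metric M a p z w =
       dird M a (\<lambda>q. kerr_metric M a q v w) p u
     + dird M a (\<lambda>q. kerr_metric M a q u w) p v
     - dird M a (\<lambda>q. kerr_metric M a q u v) p w)"

definition levi_civita :: "real \<Rightarrow> real \<Rightarrow> pt \<Rightarrow> pt \<Rightarrow> vfield \<Rightarrow> pt" where
  "levi_civita M a p x Y = dird M a Y p x + christoffel M a p x (Y p)"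


section \<open>The algebraically special frame and the horizontal distribution\<close>

text \<open>
  The expressions for \<open>e3\<close> and \<open>e4\<close> are those in ingoing coordinates, which are regular at the
  horizon; lemmas \<open>e3_boyer_lindquist\<close> and \<open>e4_boyer_lindquist\<close> below relate them to
  Boyer--Lindquist coordinates.
\<close>

definition e3 :: vfield where
  "e3 p = - v_r p"

definition e4 :: "real \<Rightarrow> real \<Rightarrow> vfield" where
  "e4 M a p = (2 * ((rad p)\<^sup>2 + a\<^sup>2) / kSigma a p) *\<^sub>R v_t p
     + (kDelta M a p / kSigma a p) *\<^sub>R v_r p + (2 * a / kSigma a p) *\<^sub>R v_phi p"

definition e1 :: "real \<Rightarrow> vfield" where
  "e1 a p = (a\<^sup>2 * sin (theta p) * cos (theta p) / kSigma a p) *\<^sub>R v_t p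
     + (rad p / kSigma a p) *\<^sub>R v_th p + (a * cos (theta p) / kSigma a p) *\<^sub>R v_phis p"

definition e2 :: "real \<Rightarrow> vfield" where
  "e2 a p = (a * rad p * sin (theta p) / kSigma a p) *\<^sub>R v_t p
     - (a * cos (theta p) / kSigma a p) *\<^sub>R v_th p + (rad p / kSigma a p) *\<^sub>R v_phis p"

definition hor :: "real \<Rightarrow> real \<Rightarrow> pt \<Rightarrow> pt set" where
  "hor M a p = {v. kerr_metric M a p v (e3 p) = 0 \<and> kerr_metric M a p v (e4 M a p) = 0}"

text \<open>
  Orthogonal projection onto the horizontal distribution; the coefficients come from
  \<open>g(e3,e3) = g(e4,e4) = 0\<close> and \<open>g(e3,e4) = -2\<close>, see \<open>hproj_orthogonal\<close> below.
\<close>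

definition hproj :: "real \<Rightarrow> real \<Rightarrow> pt \<Rightarrow> pt \<Rightarrow> pt" where
  "hproj M a p v = v + (kerr_metric M a p v (e4 M a p) / 2) *\<^sub>R e3 p
                     + (kerr_metric M a p v (e3 p) / 2) *\<^sub>R e4 M a p"

definition hform :: "real \<Rightarrow> real \<Rightarrow> form1 \<Rightarrow> bool" where
  "hform M a \<omega> \<longleftrightarrow> (\<forall>p\<in>kerr_ext M a. linear (\<omega> p) \<and> \<omega> p (e3 p) = 0 \<and> \<omega> p (e4 M a p) = 0)"


section \<open>Horizontal calculus\<close>

text \<open>\<open>(D\<^sub>X \<omega>)(Y)\<close> at \<open>p\<close> for \<open>x = X p\<close> and a horizontal vector field \<open>Y\<close>.\<close>

definition hcov :: "real \<Rightarrow> real \<Rightarrow> form1 \<Rightarrow> pt \<Rightarrow> pt \<Rightarrow> vfield \<Rightarrow> real" where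
  "hcov M a \<omega> p x Y = dird M a (\<lambda>q. \<omega> q (Y q)) p x - \<omega> p (hproj M a p (levi_civita M a p x Y))"

text \<open>
  The same as a tensor: the horizontal vector \<open>y\<close> at \<open>p\<close> is extended to the horizontal
  field obtained by projecting the constant field \<open>y\<close> pointwise.
\<close>

definition hD :: "real \<Rightarrow> real \<Rightarrow> form1 \<Rightarrow> pt \<Rightarrow> pt \<Rightarrow> pt \<Rightarrow> real" where
  "hD M a \<omega> p x y = hcov M a \<omega> p x (\<lambda>q. hproj M a q y)"

definition D3 :: "real \<Rightarrow> real \<Rightarrow> form1 \<Rightarrow> form1" where
  "D3 M a \<omega> p v = hD M a \<omega> p (e3 p) v"

definition D4 :: "real \<Rightarrow> real \<Rightarrow> form1 \<Rightarrow> form1" where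
  "D4 M a \<omega> p v = hD M a \<omega> p (e4 M a p) v"

definition D3s :: "real \<Rightarrow> real \<Rightarrow> (pt \<Rightarrow> real) \<Rightarrow> pt \<Rightarrow> real" where
  "D3s M a u p = dird M a u p (e3 p)"

definition D4s :: "real \<Rightarrow> real \<Rightarrow> (pt \<Rightarrow> real) \<Rightarrow> pt \<Rightarrow> real" where
  "D4s M a u p = dird M a u p (e4 M a p)"

definition hgrad :: "real \<Rightarrow> real \<Rightarrow> (pt \<Rightarrow> real) \<Rightarrow> form1" where
  "hgrad M a u p v = dird M a u p (hproj M a p v)"

text \<open>
  Index contractions are written out in the oriented orthonormal frame \<open>(e1, e2)\<close>.
\<close>

definition area :: "real \<Rightarrow> real \<Rightarrow> pt \<Rightarrow> pt \<Rightarrow> pt \<Rightarrow> real" where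
  "area M a p u v = kerr_metric M a p u (e1 a p) * kerr_metric M a p v (e2 a p)
                  - kerr_metric M a p u (e2 a p) * kerr_metric M a p v (e1 a p)"

definition hstar :: "real \<Rightarrow> real \<Rightarrow> form1 \<Rightarrow> form1" where
  "hstar M a \<omega> p v = area M a p v (e1 a p) * \<omega> p (e1 a p) + area M a p v (e2 a p) * \<omega> p (e2 a p)"

definition hinner :: "real \<Rightarrow> form1 \<Rightarrow> form1 \<Rightarrow> pt \<Rightarrow> real" where
  "hinner a \<omega> \<tau> p = \<omega> p (e1 a p) * \<tau> p (e1 a p) + \<omega> p (e2 a p) * \<tau> p (e2 a p)"

definition hwedge :: "real \<Rightarrow> form1 \<Rightarrow> form1 \<Rightarrow> pt \<Rightarrow> real" where
  "hwedge a \<omega> \<tau> p = \<omega> p (e1 a p) * \<tau> p (e2 a p) - \<omega> p (e2 a p) * \<tau> p (e1 a p)"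

definition hdiv :: "real \<Rightarrow> real \<Rightarrow> form1 \<Rightarrow> pt \<Rightarrow> real" where
  "hdiv M a \<omega> p = hD M a \<omega> p (e1 a p) (e1 a p) + hD M a \<omega> p (e2 a p) (e2 a p)"

definition hcurl :: "real \<Rightarrow> real \<Rightarrow> form1 \<Rightarrow> pt \<Rightarrow> real" where
  "hcurl M a \<omega> p = hD M a \<omega> p (e1 a p) (e2 a p) - hD M a \<omega> p (e2 a p) (e1 a p)"


section \<open>Connection coefficients\<close>

text \<open>A suffix \<open>b\<close> (for ``bar'') marks underlined quantities.\<close>

definition tr_chi :: "real \<Rightarrow> real \<Rightarrow> pt \<Rightarrow> real" where
  "tr_chi M a p = 2 * rad p * kDelta M a p / (kSigma a p)\<^sup>2"

definition eps_chi :: "real \<Rightarrow> real \<Rightarrow> pt \<Rightarrow> real" where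
  "eps_chi M a p = 2 * a * kDelta M a p * cos (theta p) / (kSigma a p)\<^sup>2"

definition tr_chib :: "real \<Rightarrow> pt \<Rightarrow> real" where
  "tr_chib a p = - (2 * rad p / kSigma a p)"

definition eps_chib :: "real \<Rightarrow> pt \<Rightarrow> real" where
  "eps_chib a p = 2 * a * cos (theta p) / kSigma a p"

definition omega_hat :: "real \<Rightarrow> real \<Rightarrow> pt \<Rightarrow> real" where
  "omega_hat M a p = - (2 * (a\<^sup>2 * (M - rad p) * (cos (theta p))\<^sup>2 + a\<^sup>2 * rad p - M * (rad p)\<^sup>2)
                        / (kSigma a p)\<^sup>2)"

definition chi_dot :: "real \<Rightarrow> real \<Rightarrow> form1 \<Rightarrow> form1" where
  "chi_dot M a \<omega> p v = 1/2 * tr_chi M a p * \<omega> p v + 1/2 * eps_chi M a p * hstar M a \<omega> p v"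

definition chib_dot :: "real \<Rightarrow> real \<Rightarrow> form1 \<Rightarrow> form1" where
  "chib_dot M a \<omega> p v = 1/2 * tr_chib a p * \<omega> p v + 1/2 * eps_chib a p * hstar M a \<omega> p v"

text \<open>
  Replacing the ingoing differentials by the Boyer--Lindquist ones changes neither \<open>eta\<close> nor
  \<open>etab\<close>, since the additional multiples of \<open>dr\<close> cancel; see \<open>eta_boyer_lindquist\<close> below.
\<close>

definition eta :: "real \<Rightarrow> form1" where
  "eta a p v = - (a\<^sup>2 * rad p / (kSigma a p)\<^sup>2) * (sin (theta p))\<^sup>2 * d_t p v
     - a\<^sup>2 * sin (2 * theta p) / (2 * kSigma a p) * d_th p v
     + a * rad p * ((rad p)\<^sup>2 + a\<^sup>2) / (kSigma a p)\<^sup>2 * sin (theta p) * d_phis p v"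

definition etab :: "real \<Rightarrow> form1" where
  "etab a p v = a\<^sup>2 * rad p / (kSigma a p)\<^sup>2 * (sin (theta p))\<^sup>2 * d_t p v
     - a\<^sup>2 * sin (2 * theta p) / (2 * kSigma a p) * d_th p v
     - a * rad p * ((rad p)\<^sup>2 + a\<^sup>2) / (kSigma a p)\<^sup>2 * sin (theta p) * d_phis p v"


section \<open>Maxwell's equations\<close>

text \<open>
  Sections of the dual of the horizontal distribution are compared on horizontal vectors only.
\<close>

definition maxwell ::
  "real \<Rightarrow> real \<Rightarrow> form1 \<Rightarrow> form1 \<Rightarrow> (pt \<Rightarrow> real) \<Rightarrow> (pt \<Rightarrow> real) \<Rightarrow> bool" where
  "maxwell M a \<alpha> \<alpha>b \<rho> \<sigma> \<longleftrightarrow> (\<forall>p\<in>kerr_ext M a.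
     D3s M a \<sigma> p + tr_chib a p * \<sigma> p = - hcurl M a \<alpha>b p - eps_chib a p * \<rho> p \<and>
     D3s M a \<rho> p + tr_chib a p * \<rho> p = - hdiv M a \<alpha>b p + eps_chib a p * \<sigma> p \<and>
     D4s M a \<sigma> p + tr_chi M a p * \<sigma> p =
       - hcurl M a \<alpha> p - hwedge a (\<lambda>q v. eta a q v + etab a q v) \<alpha> p + eps_chi M a p * \<rho> p \<and>
     D4s M a \<rho> p + tr_chi M a p * \<rho> p =
       hdiv M a \<alpha> p + hinner a (\<lambda>q v. eta a q v + etab a q v) \<alpha> p - eps_chi M a p * \<sigma> p \<and>
     (\<forall>v\<in>hor M a p.
        D3 M a \<alpha> p v + chib_dot M a \<alpha> p v =
          hgrad M a \<rho> p v + hstar M a (hgrad M a \<sigma>) p v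
          + 2 * eta a p v * \<rho> p + 2 * hstar M a (eta a) p v * \<sigma> p) \<and>
     (\<forall>v\<in>hor M a p.
        D4 M a \<alpha>b p v + chi_dot M a \<alpha>b p v + omega_hat M a p * \<alpha>b p v =
          - hgrad M a \<rho> p v + hstar M a (hgrad M a \<sigma>) p v
          - 2 * etab a p v * \<rho> p + 2 * hstar M a (etab a) p v * \<sigma> p))"

definition smooth_maxwell_solution ::
  "real \<Rightarrow> real \<Rightarrow> form1 \<Rightarrow> form1 \<Rightarrow> (pt \<Rightarrow> real) \<Rightarrow> (pt \<Rightarrow> real) \<Rightarrow> bool" where
  "smooth_maxwell_solution M a \<alpha> \<alpha>b \<rho> \<sigma> \<longleftrightarrow>
     smooth_form1 M a \<alpha> \<and> hform M a \<alpha> \<and> smooth_form1 M a \<alpha>b \<and> hform M a \<alpha>b \<and>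
     smooth_fun M a \<rho> \<and> smooth_fun M a \<sigma> \<and> maxwell M a \<alpha> \<alpha>b \<rho> \<sigma>"


section \<open>Transformed quantities\<close>

definition rho_hat :: "real \<Rightarrow> (pt \<Rightarrow> real) \<Rightarrow> (pt \<Rightarrow> real) \<Rightarrow> pt \<Rightarrow> real" where
  "rho_hat a \<rho> \<sigma> p =
     1/4 * kSigma a p * ((tr_chib a p)\<^sup>2 - (eps_chib a p)\<^sup>2) * (kSigma a p * \<rho> p)
     + 1/2 * kSigma a p * eps_chib a p * tr_chib a p * (kSigma a p * \<sigma> p)"

definition sigma_hat :: "real \<Rightarrow> (pt \<Rightarrow> real) \<Rightarrow> (pt \<Rightarrow> real) \<Rightarrow> pt \<Rightarrow> real" where
  "sigma_hat a \<rho> \<sigma> p =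
     - (1/2 * kSigma a p * eps_chib a p * tr_chib a p * (kSigma a p * \<rho> p))
     + 1/4 * kSigma a p * ((tr_chib a p)\<^sup>2 - (eps_chib a p)\<^sup>2) * (kSigma a p * \<sigma> p)"

definition frakT :: "real \<Rightarrow> real \<Rightarrow> form1 \<Rightarrow> form1" where
  "frakT M a \<alpha> p v = 1/2 * kSigma a p * (D3 M a \<alpha> p v + chib_dot M a \<alpha> p v)"

definition frakTb :: "real \<Rightarrow> real \<Rightarrow> form1 \<Rightarrow> form1" where
  "frakTb M a \<alpha>b p v =
     1/2 * kSigma a p * (D4 M a \<alpha>b p v + chi_dot M a \<alpha>b p v + omega_hat M a p * \<alpha>b p v)"


section \<open>Consistency checks\<close>

lemma vec3_inner: "(vector [x1, x2, x3] :: real^3) \<bullet> vector [y1, y2, y3] = x1 * y1 + x2 * y2 + x3 * y3"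
  by (simp add: inner_vec_def sum_3)

lemma sph_inner:
  "sph th ph \<bullet> sph th ph = 1" "sph th ph \<bullet> sph_th th ph = 0" "sph th ph \<bullet> sph_ph ph = 0"
  "sph_th th ph \<bullet> sph th ph = 0" "sph_th th ph \<bullet> sph_th th ph = 1" "sph_th th ph \<bullet> sph_ph ph = 0"
  "sph_ph ph \<bullet> sph th ph = 0" "sph_ph ph \<bullet> sph_th th ph = 0" "sph_ph ph \<bullet> sph_ph ph = 1"
proof -
  obtain s c s' c' where v: "s = sin th" "c = cos th" "s' = sin ph" "c' = cos ph" by simp
  then have e: "s\<^sup>2 + c\<^sup>2 = 1" "s'\<^sup>2 + c'\<^sup>2 = 1" by simp_all
  have "s * c' * (s * c') + s * s' * (s * s') + c * c = 1" "c * c' * (c * c') + c * s' * (c * s') + s * s = 1"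
    "c * c' * (s * c') + c * s' * (s * s') = c * s"
    using e by algebra+
  note e = e[unfolded v] this[unfolded v]
  show "sph th ph \<bullet> sph th ph = 1" "sph th ph \<bullet> sph_th th ph = 0" "sph th ph \<bullet> sph_ph ph = 0"
    "sph_th th ph \<bullet> sph th ph = 0" "sph_th th ph \<bullet> sph_th th ph = 1" "sph_th th ph \<bullet> sph_ph ph = 0"
    "sph_ph ph \<bullet> sph th ph = 0" "sph_ph ph \<bullet> sph_th th ph = 0" "sph_ph ph \<bullet> sph_ph ph = 1"
    unfolding sph_def sph_th_def sph_ph_def vec3_inner using e
    by (simp_all add: power2_eq_square) (simp_all add: algebra_simps flip: distrib_left)
qed

text \<open>\<open>(r, theta, phi)\<close> are spherical coordinates of the spatial part.\<close>

lemma spherical: "snd p = rad p *\<^sub>R sph (theta p) (phi p)"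
proof (cases "snd p = 0")
  case True
  then show ?thesis by (simp add: rad_def)
next
  case False
  let ?y = "snd p" and ?z = "Complex (snd p $ 1) (snd p $ 2)"
  have r: "rad p > 0" using False by (simp add: rad_def)
  have r2: "(rad p)\<^sup>2 = (?y$1)\<^sup>2 + (?y$2)\<^sup>2 + (?y$3)\<^sup>2"
    unfolding rad_def power2_norm_eq_inner by (simp add: inner_vec_def sum_3 power2_eq_square)
  have "\<bar>?y $ 3\<bar> \<le> rad p" unfolding rad_def by (rule component_le_norm_cart)
  then have b: "- 1 \<le> ?y $ 3 / rad p" "?y $ 3 / rad p \<le> 1" using r by (auto simp: field_simps)
  have c: "rad p * cos (theta p) = ?y $ 3" using b r by (simp add: theta_def)
  have "0 \<le> sin (theta p)" unfolding theta_def using b by (simp add: sin_ge_zero arccos_lbound arccos_ubound)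
  moreover have "(rad p * sin (theta p))\<^sup>2 = (cmod ?z)\<^sup>2"
  proof -
    have "(rad p * sin (theta p))\<^sup>2 = (rad p)\<^sup>2 - (rad p * cos (theta p))\<^sup>2"
      by (simp add: power_mult_distrib sin_squared_eq algebra_simps)
    then show ?thesis using r2 c by (simp add: cmod_power2)
  qed
  ultimately have s: "rad p * sin (theta p) = cmod ?z"
    using r by (metis mult_nonneg_nonneg less_imp_le norm_ge_zero power2_eq_imp_eq)
  have z: "?z = rcis (cmod ?z) (phi p)" unfolding phi_def by (simp add: rcis_cmod_Arg)
  have "?y $ 1 = rad p * sin (theta p) * cos (phi p)" "?y $ 2 = rad p * sin (theta p) * sin (phi p)"
    using arg_cong[OF z, of Re] arg_cong[OF z, of Im] s by simp_all
  then show ?thesis using c by (simp add: vec_eq_iff forall_3 sph_def mult.assoc)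
qed

lemma coordinate_vectors:
  "((\<lambda>r. (t, r *\<^sub>R sph th ph)) has_vector_derivative (0, sph th ph)) (at r)"
  "((\<lambda>th. (t, r *\<^sub>R sph th ph)) has_vector_derivative (0, r *\<^sub>R sph_th th ph)) (at th)"
  "((\<lambda>ph. (t, r *\<^sub>R sph th ph)) has_vector_derivative (0, (r * sin th) *\<^sub>R sph_ph ph)) (at ph)"
proof -
  have e: "(vector [x, y, z] :: real^3) = x *\<^sub>R axis 1 1 + y *\<^sub>R axis 2 1 + z *\<^sub>R axis 3 1" for x y z
    by (simp add: vec_eq_iff forall_3 axis_def)
  show "((\<lambda>r. (t, r *\<^sub>R sph th ph)) has_vector_derivative (0, sph th ph)) (at r)"
    "((\<lambda>th. (t, r *\<^sub>R sph th ph)) has_vector_derivative (0, r *\<^sub>R sph_th th ph)) (at th)"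
    "((\<lambda>ph. (t, r *\<^sub>R sph th ph)) has_vector_derivative (0, (r * sin th) *\<^sub>R sph_ph ph)) (at ph)"
    unfolding sph_def sph_th_def sph_ph_def e
    by (auto intro!: derivative_eq_intros simp: algebra_simps)
qed

lemma covectors:
  assumes "rad p \<noteq> 0"
  shows "d_t p (v_t p) = 1" "d_t p (v_r p) = 0" "d_t p (v_th p) = 0" "d_t p (v_phis p) = 0"
    "d_r p (v_t p) = 0" "d_r p (v_r p) = 1" "d_r p (v_th p) = 0" "d_r p (v_phis p) = 0"
    "d_th p (v_t p) = 0" "d_th p (v_r p) = 0" "d_th p (v_th p) = 1" "d_th p (v_phis p) = 0"
    "d_phis p (v_t p) = 0" "d_phis p (v_r p) = 0" "d_phis p (v_th p) = 0" "d_phis p (v_phis p) = 1"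
  using assms
  by (simp_all add: d_t_def d_r_def d_th_def d_phis_def v_t_def v_r_def v_th_def v_phis_def sph_inner)

lemma covectors_linear:
  "linear (d_t p)" "linear (d_r p)" "linear (d_th p)" "linear (d_phis p)"
  by (auto intro!: linearI simp: d_t_def d_r_def d_th_def d_phis_def inner_add_right add_divide_distrib)

text \<open>
  With $\bar t = t + \int (s^2+a^2)/\Delta\,ds$ and $\bar\phi = \phi + \int a/\Delta\,ds$, the
  Boyer--Lindquist $\partial_r$ and the differentials $dt$, $\sin\theta\,d\phi$ read as follows,
  while $\partial_t$, $\partial_\theta$, $\partial_\phi$ agree with the ingoing ones.
\<close>

definition bl_v_r :: "real \<Rightarrow> real \<Rightarrow> vfield" where
  "bl_v_r M a p = v_r p + (((rad p)\<^sup>2 + a\<^sup>2) / kDelta M a p) *\<^sub>R v_t p + (a / kDelta M a p) *\<^sub>R v_phi p"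

definition bl_d_t :: "real \<Rightarrow> real \<Rightarrow> form1" where
  "bl_d_t M a p v = d_t p v - ((rad p)\<^sup>2 + a\<^sup>2) / kDelta M a p * d_r p v"

definition bl_d_phis :: "real \<Rightarrow> real \<Rightarrow> form1" where
  "bl_d_phis M a p v = d_phis p v - a * sin (theta p) / kDelta M a p * d_r p v"

lemma e3_boyer_lindquist:
  "e3 p = (((rad p)\<^sup>2 + a\<^sup>2) / kDelta M a p) *\<^sub>R v_t p - bl_v_r M a p + (a / kDelta M a p) *\<^sub>R v_phi p"
  by (simp add: e3_def bl_v_r_def)

lemma e4_boyer_lindquist:
  assumes "kDelta M a p \<noteq> 0"
  shows "e4 M a p = (((rad p)\<^sup>2 + a\<^sup>2) / kSigma a p) *\<^sub>R v_t p
     + (kDelta M a p / kSigma a p) *\<^sub>R bl_v_r M a p + (a / kSigma a p) *\<^sub>R v_phi p"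
proof -
  have "(2 * X / kSigma a p) *\<^sub>R w = (X / kSigma a p) *\<^sub>R w
      + (kDelta M a p / kSigma a p) *\<^sub>R (X / kDelta M a p) *\<^sub>R w" for X and w :: pt
    using assms by (simp flip: scaleR_add_left)
  from this[of "(rad p)\<^sup>2 + a\<^sup>2" "v_t p"] this[of a "v_phi p"] show ?thesis
    by (simp add: e4_def bl_v_r_def scaleR_add_right algebra_simps)
qed

lemma eta_boyer_lindquist:
  "eta a p v = - (a\<^sup>2 * rad p / (kSigma a p)\<^sup>2) * (sin (theta p))\<^sup>2 * bl_d_t M a p v
     - a\<^sup>2 * sin (2 * theta p) / (2 * kSigma a p) * d_th p v
     + a * rad p * ((rad p)\<^sup>2 + a\<^sup>2) / (kSigma a p)\<^sup>2 * sin (theta p) * bl_d_phis M a p v"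
    "etab a p v = a\<^sup>2 * rad p / (kSigma a p)\<^sup>2 * (sin (theta p))\<^sup>2 * bl_d_t M a p v
     - a\<^sup>2 * sin (2 * theta p) / (2 * kSigma a p) * d_th p v
     - a * rad p * ((rad p)\<^sup>2 + a\<^sup>2) / (kSigma a p)\<^sup>2 * sin (theta p) * bl_d_phis M a p v"
proof -
  have *: "a\<^sup>2 * rad p / (kSigma a p)\<^sup>2 * (sin (theta p))\<^sup>2 * (((rad p)\<^sup>2 + a\<^sup>2) / kDelta M a p * d_r p v)
    = a * rad p * ((rad p)\<^sup>2 + a\<^sup>2) / (kSigma a p)\<^sup>2 * sin (theta p) * (a * sin (theta p) / kDelta M a p * d_r p v)"
    by (simp add: power2_eq_square)
  show "eta a p v = - (a\<^sup>2 * rad p / (kSigma a p)\<^sup>2) * (sin (theta p))\<^sup>2 * bl_d_t M a p v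
     - a\<^sup>2 * sin (2 * theta p) / (2 * kSigma a p) * d_th p v
     + a * rad p * ((rad p)\<^sup>2 + a\<^sup>2) / (kSigma a p)\<^sup>2 * sin (theta p) * bl_d_phis M a p v"
    "etab a p v = a\<^sup>2 * rad p / (kSigma a p)\<^sup>2 * (sin (theta p))\<^sup>2 * bl_d_t M a p v
     - a\<^sup>2 * sin (2 * theta p) / (2 * kSigma a p) * d_th p v
     - a * rad p * ((rad p)\<^sup>2 + a\<^sup>2) / (kSigma a p)\<^sup>2 * sin (theta p) * bl_d_phis M a p v"
    unfolding eta_def etab_def bl_d_t_def bl_d_phis_def right_diff_distrib minus_mult_left[symmetric] *
    by simp_all
qed

lemma kerr_ext_pos:
  assumes "M > 0" "p \<in> kerr_ext M a" "\<bar>a\<bar> \<le> M"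
  shows "rad p > 0" "kSigma a p > 0"
proof -
  have "a\<^sup>2 \<le> M\<^sup>2" using assms by (simp add: abs_le_square_iff[symmetric])
  then have "r_plus M a > 0" using assms(1) by (simp add: r_plus_def add_pos_nonneg)
  then show "rad p > 0" using assms by (simp add: kerr_ext_def)
  then show "kSigma a p > 0" by (simp add: kSigma_def add_pos_nonneg)
qed

lemma kDelta_eq:
  assumes "\<bar>a\<bar> \<le> M"
  shows "kDelta M a p = (rad p)\<^sup>2 - 2 * M * rad p + a\<^sup>2"
proof -
  have "a\<^sup>2 \<le> M\<^sup>2" using assms by (simp add: abs_le_square_iff[symmetric])
  then have "(sqrt (M\<^sup>2 - a\<^sup>2))\<^sup>2 = M\<^sup>2 - a\<^sup>2" by simp
  then show ?thesis unfolding kDelta_def r_plus_def r_minus_def by (simp add: algebra_simps power2_eq_square)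
qed

lemma frame_coords:
  assumes "rad p \<noteq> 0"
  shows "d_t p (e3 p) = 0" "d_r p (e3 p) = -1" "d_th p (e3 p) = 0" "d_phis p (e3 p) = 0"
    "d_t p (e4 M a p) = 2 * ((rad p)\<^sup>2 + a\<^sup>2) / kSigma a p" "d_r p (e4 M a p) = kDelta M a p / kSigma a p"
    "d_th p (e4 M a p) = 0" "d_phis p (e4 M a p) = 2 * a * sin (theta p) / kSigma a p"
    "d_t p (e1 a p) = a\<^sup>2 * sin (theta p) * cos (theta p) / kSigma a p" "d_r p (e1 a p) = 0"
    "d_th p (e1 a p) = rad p / kSigma a p" "d_phis p (e1 a p) = a * cos (theta p) / kSigma a p"
    "d_t p (e2 a p) = a * rad p * sin (theta p) / kSigma a p" "d_r p (e2 a p) = 0"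
    "d_th p (e2 a p) = - (a * cos (theta p) / kSigma a p)" "d_phis p (e2 a p) = rad p / kSigma a p"
  using covectors[OF assms]
  by (simp_all add: e1_def e2_def e3_def e4_def v_phi_def covectors_linear
      linear_add linear_diff linear_scale linear_neg)

lemma frame_algebra:
  fixes r a c s S D :: real
  assumes S0: "S \<noteq> 0" and S: "S = r\<^sup>2 + a\<^sup>2 * c\<^sup>2" and s: "s\<^sup>2 = 1 - c\<^sup>2"
  defines "G \<equiv> \<lambda>t x h f t' x' h' f'. - (1 - (r\<^sup>2 + a\<^sup>2 - D) / S) * (t * t') + (t * x' + x * t') + S * (h * h')
     + ((r\<^sup>2 + a\<^sup>2)\<^sup>2 - D * a\<^sup>2 * s\<^sup>2) / S * (f * f') - a * s * (x * f' + f * x')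
     - a * (r\<^sup>2 + a\<^sup>2 - D) / S * s * (t * f' + f * t')"
  shows 
    "G 0 (-1) 0 0 (2 * (r\<^sup>2 + a\<^sup>2) / S) (D / S) 0 (2 * a * s / S) = - 2" (is ?A)
    "G (2 * (r\<^sup>2 + a\<^sup>2) / S) (D / S) 0 (2 * a * s / S) (2 * (r\<^sup>2 + a\<^sup>2) / S) (D / S) 0 (2 * a * s / S) = 0" (is ?B)
    "G (a\<^sup>2 * s * c / S) 0 (r / S) (a * c / S) 0 (-1) 0 0 = 0" (is ?C)
    "G (a\<^sup>2 * s * c / S) 0 (r / S) (a * c / S) (2 * (r\<^sup>2 + a\<^sup>2) / S) (D / S) 0 (2 * a * s / S) = 0" (is ?D)
    "G (a * r * s / S) 0 (- (a * c / S)) (r / S) 0 (-1) 0 0 = 0" (is ?E)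
    "G (a * r * s / S) 0 (- (a * c / S)) (r / S) (2 * (r\<^sup>2 + a\<^sup>2) / S) (D / S) 0 (2 * a * s / S) = 0" (is ?F)
    "G (a\<^sup>2 * s * c / S) 0 (r / S) (a * c / S) (a\<^sup>2 * s * c / S) 0 (r / S) (a * c / S) = 1" (is ?H)
    "G (a\<^sup>2 * s * c / S) 0 (r / S) (a * c / S) (a * r * s / S) 0 (- (a * c / S)) (r / S) = 0" (is ?I)
    "G (a * r * s / S) 0 (- (a * c / S)) (r / S) (a * r * s / S) 0 (- (a * c / S)) (r / S) = 1" (is ?J)
proof -
  have p: "S = r\<^sup>2 + a\<^sup>2 - (a * s)\<^sup>2" using S s by algebra
  define u where "u = a * s"
  define v where "v = a * c"
  define X where "X = r\<^sup>2 + a\<^sup>2"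
  have w: "S = X - u\<^sup>2" "S = r\<^sup>2 + v\<^sup>2" using p S by (simp_all add: X_def u_def v_def power_mult_distrib)
  have G: "G t x h f t' x' h' f' = - (1 - (X - D) / S) * (t * t') + (t * x' + x * t') + S * (h * h')
     + (X\<^sup>2 - D * u\<^sup>2) / S * (f * f') - u * (x * f' + f * x') - (X - D) / S * u * (t * f' + f * t')" for t x h f t' x' h' f'
    by (simp add: G_def X_def u_def power_mult_distrib mult_ac)
  have k: "a\<^sup>2 * s * c / S = u * v / S" "a * r * s / S = r * u / S" "2 * a * s / S = 2 * u / S" "a * c / S = v / S"
    by (simp_all add: u_def v_def power2_eq_square mult_ac)
  note kk = G k X_def[symmetric]
  have z: "S * inverse S = 1" using S0 by simp
  have X: "X = S + u\<^sup>2" and R: "r\<^sup>2 = S - v\<^sup>2" using w by simp_all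
  show ?A unfolding kk unfolding divide_inverse using z X by algebra
  show ?B unfolding kk unfolding divide_inverse using z X by algebra
  show ?C unfolding kk by (simp add: mult_ac)
  show ?D unfolding kk unfolding divide_inverse using z X by algebra
  show ?E unfolding kk by (simp add: mult_ac)
  show ?F unfolding kk unfolding divide_inverse using z X by algebra
  show ?H unfolding kk unfolding divide_inverse using z X R by algebra
  show ?I unfolding kk unfolding divide_inverse using z X R by algebra
  show ?J unfolding kk unfolding divide_inverse using z X R by algebra
qed

lemma frame_products:
  assumes "M > 0" "\<bar>a\<bar> \<le> M" "p \<in> kerr_ext M a"
  defines "g \<equiv> kerr_metric M a p"
  shows "g (e3 p) (e3 p) = 0" "g (e3 p) (e4 M a p) = - 2" "g (e4 M a p) (e4 M a p) = 0"
    "g (e1 a p) (e3 p) = 0" "g (e1 a p) (e4 M a p) = 0" "g (e2 a p) (e3 p) = 0" "g (e2 a p) (e4 M a p) = 0"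
    "g (e1 a p) (e1 a p) = 1" "g (e1 a p) (e2 a p) = 0" "g (e2 a p) (e2 a p) = 1"
proof -
  have r: "rad p \<noteq> 0" and S0: "kSigma a p \<noteq> 0" using kerr_ext_pos[OF assms(1,3,2)] by auto
  have s: "(sin (theta p))\<^sup>2 = 1 - (cos (theta p))\<^sup>2" by (simp add: sin_squared_eq)
  have S: "kSigma a p = (rad p)\<^sup>2 + a\<^sup>2 * (cos (theta p))\<^sup>2" by (simp add: kSigma_def)
  have m: "2 * M * rad p = (rad p)\<^sup>2 + a\<^sup>2 - kDelta M a p"
    "2 * a * M * rad p = a * ((rad p)\<^sup>2 + a\<^sup>2 - kDelta M a p)"
    unfolding kDelta_eq[OF assms(2)] by (simp_all add: algebra_simps)
  have g: "g u v = - (1 - ((rad p)\<^sup>2 + a\<^sup>2 - kDelta M a p) / kSigma a p) * (d_t p u * d_t p v)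
     + (d_t p u * d_r p v + d_r p u * d_t p v) + kSigma a p * (d_th p u * d_th p v)
     + (((rad p)\<^sup>2 + a\<^sup>2)\<^sup>2 - kDelta M a p * a\<^sup>2 * (sin (theta p))\<^sup>2) / kSigma a p * (d_phis p u * d_phis p v)
     - a * sin (theta p) * (d_r p u * d_phis p v + d_phis p u * d_r p v)
     - a * ((rad p)\<^sup>2 + a\<^sup>2 - kDelta M a p) / kSigma a p * sin (theta p)
         * (d_t p u * d_phis p v + d_phis p u * d_t p v)" for u v
    unfolding g_def kerr_metric_def m ..
  show "g (e3 p) (e3 p) = 0" unfolding g frame_coords[OF r] by simp
  show "g (e3 p) (e4 M a p) = - 2" "g (e4 M a p) (e4 M a p) = 0"
    "g (e1 a p) (e3 p) = 0" "g (e1 a p) (e4 M a p) = 0" "g (e2 a p) (e3 p) = 0" "g (e2 a p) (e4 M a p) = 0"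
    "g (e1 a p) (e1 a p) = 1" "g (e1 a p) (e2 a p) = 0" "g (e2 a p) (e2 a p) = 1"
    unfolding g frame_coords[OF r] by (rule frame_algebra[OF S0 S s])+
qed

lemma metric_sym: "kerr_metric M a p u v = kerr_metric M a p v u"
  by (simp add: kerr_metric_def mult_ac add_ac)

lemma metric_bilinear:
  "linear (kerr_metric M a p u)" "linear (\<lambda>u. kerr_metric M a p u v)"
proof -
  obtain c1 c2 c3 c4 c5 where g: "kerr_metric M a p u v =
       c1 * (d_t p u * d_t p v) + (d_t p u * d_r p v + d_r p u * d_t p v) + c2 * (d_th p u * d_th p v)
       + c3 * (d_phis p u * d_phis p v) - c4 * (d_r p u * d_phis p v + d_phis p u * d_r p v)
       - c5 * (d_t p u * d_phis p v + d_phis p u * d_t p v)" for u v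
    unfolding kerr_metric_def by blast
  note l = covectors_linear[THEN linear_add] covectors_linear[THEN linear_scale]
  have *: "linear (kerr_metric M a p u)" for u
    by (rule linearI) (simp_all add: g l algebra_simps del: add_Pair scaleR_Pair)
  show "linear (kerr_metric M a p u)" by (rule *)
  show "linear (\<lambda>u. kerr_metric M a p u v)" using *[of v] by (subst metric_sym)
qed

lemma covectors_separate:
  assumes "rad p \<noteq> 0" "d_t p z = 0" "d_r p z = 0" "d_th p z = 0" "d_phis p z = 0"
  shows "z = 0"
proof -
  let ?y = "snd z" and ?s = "sin (theta p)" and ?c = "cos (theta p)" and ?s' = "sin (phi p)" and ?c' = "cos (phi p)"
  obtain y1 y2 y3 where y: "snd z $ 1 = y1" "snd z $ 2 = y2" "snd z $ 3 = y3" by blast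
  have r: "?s * ?c' * y1 + ?s * ?s' * y2 + ?c * y3 = 0"
    and h: "?c * ?c' * y1 + ?c * ?s' * y2 - ?s * y3 = 0" and f: "- (?s' * y1) + ?c' * y2 = 0"
    using assms by (simp_all add: d_r_def d_th_def d_phis_def sph_def sph_th_def sph_ph_def inner_vec_def sum_3 y)
  have e: "?s\<^sup>2 + ?c\<^sup>2 = 1" "?s'\<^sup>2 + ?c'\<^sup>2 = 1" by simp_all
  define X where "X = ?c' * y1 + ?s' * y2"
  have r': "?s * X + ?c * y3 = 0" and h': "?c * X - ?s * y3 = 0" using r h by (simp_all add: X_def algebra_simps)
  have X: "X = 0" and 3: "y3 = 0" using r' h' e(1) by algebra+
  then have 1: "y1 = 0" and 2: "y2 = 0" using f e(2) unfolding X_def by algebra+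
  show ?thesis using assms(2) 1 2 3 y by (simp add: d_t_def prod_eq_iff vec_eq_iff forall_3)
qed

lemma metric_nondegenerate:
  assumes "M > 0" "\<bar>a\<bar> \<le> M" "p \<in> kerr_ext M a" and z: "\<And>w. kerr_metric M a p z w = 0"
  shows "z = 0"
proof -
  have r: "rad p \<noteq> 0" and S0: "kSigma a p \<noteq> 0" using kerr_ext_pos[OF assms(1,3,2)] by auto
  define X m S u t x h f where "X = (rad p)\<^sup>2 + a\<^sup>2" and "m = 2 * M * rad p" and "S = kSigma a p"
    and "u = a * sin (theta p)" and "t = d_t p z" and "x = d_r p z" and "h = d_th p z" and "f = d_phis p z"
  note defs = X_def m_def S_def u_def t_def x_def h_def f_def
  have XS: "X = S + u\<^sup>2"
    by (simp add: defs kSigma_def power_mult_distrib sin_squared_eq algebra_simps)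
  have D: "kDelta M a p = X - m" unfolding kDelta_eq[OF assms(2)] defs by simp
  have "- (1 - m / S) * t + x - m / S * u * f = 0" "t - u * f = 0" "S * h = 0"
    "(X\<^sup>2 - (X - m) * u\<^sup>2) / S * f - u * x - m / S * u * t = 0"
    using z[of "v_t p"] z[of "v_r p"] z[of "v_th p"] z[of "v_phis p"]
    unfolding kerr_metric_def covectors[OF r] D
    by (simp_all add: defs power_mult_distrib mult_ac)
  then have h: "h = 0" and t: "t = u * f" and x: "x = u * f"
    and *: "(X\<^sup>2 - (X - m) * u\<^sup>2) / S * f - u * (u * f) - m / S * u * (u * f) = 0"
    using S0 by (auto simp: S_def algebra_simps)
  have "S * f = ((X\<^sup>2 - (X - m) * u\<^sup>2) / S * f - u * (u * f) - m / S * u * (u * f))"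
    using S0 unfolding XS by (simp add: S_def[symmetric] field_simps power2_eq_square)
  then have f: "f = 0" using * S0 by (simp add: S_def)
  show ?thesis using covectors_separate[OF r] h t x f by (simp add: defs)
qed

lemma hproj_orthogonal:
  assumes "M > 0" "\<bar>a\<bar> \<le> M" "p \<in> kerr_ext M a"
  shows "hproj M a p v \<in> hor M a p" "v \<in> hor M a p \<Longrightarrow> hproj M a p v = v"
    "hproj M a p v - v \<in> span {e3 p, e4 M a p}"
proof -
  note f = frame_products[OF assms]
  have f': "kerr_metric M a p (e4 M a p) (e3 p) = - 2" using f(2) metric_sym by metis
  show "hproj M a p v \<in> hor M a p"
    by (simp add: hor_def hproj_def linear_add[OF metric_bilinear(2)] linear_scale[OF metric_bilinear(2)] f f')
  show "v \<in> hor M a p \<Longrightarrow> hproj M a p v = v" by (simp add: hor_def hproj_def)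
  show "hproj M a p v - v \<in> span {e3 p, e4 M a p}"
    by (simp add: hproj_def span_add span_mul span_base)
qed

end

theory Submission
  imports Defs
begin

text \<open>
  Write \<open>\<zeta> = r + i a cos \<theta>\<close>, so that \<open>\<Sigma> = |\<zeta>|\<^sup>2\<close>, and \<open>\<Phi> = \<rho> + i \<sigma>\<close>.  The transformed pair is
  \<open>rho_hat + i sigma_hat = \<zeta>\<^sup>2 \<Phi>\<close>, and the proposition says that \<open>\<zeta>\<^sup>2\<close> is an integrating factor for all
  Maxwell equations at once: differentiating \<open>\<zeta>\<^sup>2\<close> produces exactly the terms that cancel those
  without derivatives of the unknowns.

  In the null directions the zeroth-order coefficient is a multiple of \<open>tr_chib + i eps_chib = - 2 / \<zeta>\<close>
  (lemma \<open>chi_zeta2\<close>), while \<open>e3(\<zeta>) = - 1\<close> and \<open>e4(\<zeta>) = \<Delta> / \<Sigma>\<close> are real; this gives the cancellation in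
  \<open>null_derivative_hat\<close>.  Along \<open>e4\<close> there remain the terms with \<open>\<eta> + etab\<close>.  On horizontal vectors
  \<open>d\<Sigma> = \<Sigma> (\<eta> + etab)\<close>, so they are what the Leibniz rule produces when \<open>\<Sigma>\<close> is moved under the
  divergence and the curl (\<open>div_curl_kSigma\<close>).  The Leibniz rule itself (\<open>hD_scale\<close>) is a
  feature of every covariant derivative that differs from a directional derivative by a tensor.

  In the horizontal directions the last two Maxwell equations express \<open>T\<close> and \<open>Tb\<close> (for
  \<open>frakT\<close> and \<open>frakTb\<close>) by the gradients of \<open>\<rho>\<close> and \<open>\<sigma>\<close>.  Since the horizontal star squares to \<open>- 1\<close>,
  with \<open>X = T - Tb\<close> and \<open>Y\<close> the star of \<open>T + Tb\<close> they combine to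
  \<open>X - i Y = \<Sigma> (d\<Phi> + ((\<eta> + etab) - i star(\<eta> - etab)) \<Phi>)\<close>.  The factor in front of \<open>\<Phi>\<close> is
  \<open>d(\<zeta>\<^sup>2) / \<zeta>\<^sup>2\<close> (\<open>weights_frame_derivatives\<close>), so the right-hand side is \<open>(\<Sigma> / \<zeta>\<^sup>2) d(\<zeta>\<^sup>2 \<Phi>)\<close>.
\<close>

section \<open>Derivatives within the exterior\<close>

text \<open>
  Points of the horizon are not interior, but the complement of the exterior is a cylinder over a
  ball around the origin, so on any line through a point of the exterior one of the two directions
  does not decrease the radius.  This is enough for derivatives within the exterior to be unique.
\<close>

lemma dird_eqI:
  assumes p: "p \<in> kerr_ext M a" and f: "(f has_derivative f') (at p within kerr_ext M a)"
  shows "dird M a f p = f'"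
  unfolding dird_def
proof (rule ext, rule fun_cong, rule frechet_derivative_unique_within)
  show "(f has_derivative frechet_derivative f (at p within kerr_ext M a)) (at p within kerr_ext M a)"
    using f frechet_derivative_works differentiableI by blast
  show "(f has_derivative f') (at p within kerr_ext M a)" by (rule f)
next
  fix i :: pt and e :: real
  assume "e > 0"
  define d where "d = (if snd p \<bullet> snd i \<ge> 0 then e / 2 else - (e / 2))"
  have "norm (snd p) \<le> norm (snd p + d *\<^sub>R snd i)"
  proof (rule power2_le_imp_le)
    have "0 \<le> d * (snd p \<bullet> snd i)"
      using \<open>e > 0\<close> by (auto simp: d_def mult_nonneg_nonpos split: if_splits intro!: mult_nonneg_nonneg)
    moreover have "0 \<le> d * (d * (snd i \<bullet> snd i))" by (simp flip: mult.assoc)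
    ultimately show "(norm (snd p))\<^sup>2 \<le> (norm (snd p + d *\<^sub>R snd i))\<^sup>2"
      by (simp add: power2_norm_eq_inner inner_add_left inner_add_right inner_commute)
  qed simp
  then have "p + d *\<^sub>R i \<in> kerr_ext M a" using p by (simp add: kerr_ext_def rad_def)
  moreover have "0 < \<bar>d\<bar>" "\<bar>d\<bar> < e" using \<open>e > 0\<close> by (auto simp: d_def)
  ultimately show "\<exists>d. 0 < \<bar>d\<bar> \<and> \<bar>d\<bar> < e \<and> p + d *\<^sub>R i \<in> kerr_ext M a" by blast
qed

lemma smooth_fun_has_derivative:
  assumes f: "smooth_fun M a f" and p: "p \<in> kerr_ext M a"
  shows "(f has_derivative dird M a f p) (at p within kerr_ext M a)"
proof -
  obtain U h where U: "open U" "kerr_ext M a \<subseteq> U" and h: "Ck_on 1 U h"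
    and eq: "\<And>q. q \<in> kerr_ext M a \<Longrightarrow> h q = f q"
    using f unfolding smooth_fun_def by blast
  have "h differentiable at p within U" using h U p by (auto simp: differentiable_on_def)
  then have "h differentiable at p within kerr_ext M a" using U(2) by (rule differentiable_subset)
  then obtain h' where "(h has_derivative h') (at p within kerr_ext M a)" by (auto simp: differentiable_def)
  then have "(f has_derivative h') (at p within kerr_ext M a)"
    by (rule has_derivative_transform[OF p _, rotated]) (simp add: eq)
  from dird_eqI[OF p this] this show ?thesis by simp
qed

lemma rad_has_derivative:
  assumes r: "rad p \<noteq> 0"
  shows "(rad has_derivative d_r p) (at p within S)"
proof -
  have "snd p \<noteq> 0" using r by (simp add: rad_def)
  have eq: "(\<lambda>v. (snd p \<bullet> snd v) / norm (snd p)) = d_r p"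
  proof
    fix v :: pt
    have "snd p \<bullet> snd v = rad p * (sph (theta p) (phi p) \<bullet> snd v)"
      by (subst spherical) simp
    then show "(snd p \<bullet> snd v) / norm (snd p) = d_r p v"
      using r by (simp add: d_r_def rad_def)
  qed
  have "(norm has_derivative (\<lambda>y. y \<bullet> sgn (snd p))) (at (snd p))"
    using \<open>snd p \<noteq> 0\<close> by (simp add: has_derivative_norm)
  from has_derivative_compose[OF has_derivative_snd[OF has_derivative_ident] this]
  have "((\<lambda>q. norm (snd q)) has_derivative (\<lambda>v. snd v \<bullet> sgn (snd p))) (at p within S)" .
  moreover have "(\<lambda>v::pt. snd v \<bullet> sgn (snd p)) = d_r p"
    unfolding eq[symmetric] sgn_div_norm by (auto simp: inner_commute divide_inverse)
  ultimately show ?thesis by (simp add: rad_def[abs_def])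
qed

text \<open>
  The angle \<open>theta\<close> is not differentiable on the axis, but \<open>cos theta\<close>, through which alone it enters
  \<open>\<Sigma>\<close> and \<open>\<zeta>\<close>, is the quotient of a linear coordinate by the radius.
\<close>

lemma cos_theta_eq: "rad p \<noteq> 0 \<Longrightarrow> cos (theta p) = snd p $ 3 / rad p"
  using arg_cong[OF spherical[of p], of "\<lambda>y. y $ 3"] by (simp add: sph_def)

lemma cos_theta_has_derivative:
  assumes r: "rad p \<noteq> 0" and S: "p \<in> S" "\<And>q. q \<in> S \<Longrightarrow> rad q \<noteq> 0"
  shows "((\<lambda>q. cos (theta q)) has_derivative (\<lambda>v. - sin (theta p) * d_th p v)) (at p within S)"
proof -
  have 3: "snd v $ 3 = cos (theta p) * d_r p v - sin (theta p) * (rad p * d_th p v)" for v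
  proof -
    define s c s' c' where d: "s = sin (theta p)" "c = cos (theta p)" "s' = sin (phi p)" "c' = cos (phi p)"
    have e: "s\<^sup>2 + c\<^sup>2 = 1" by (simp add: d)
    have "d_r p v = s * c' * snd v $ 1 + s * s' * snd v $ 2 + c * snd v $ 3"
      "rad p * d_th p v = c * c' * snd v $ 1 + c * s' * snd v $ 2 - s * snd v $ 3"
      using r by (simp_all add: d_r_def d_th_def sph_def sph_th_def inner_vec_def sum_3 d)
    then have "snd v $ 3 = c * d_r p v - s * (rad p * d_th p v)" using e by algebra
    then show ?thesis by (simp add: d)
  qed
  have "((\<lambda>q::pt. snd q $ 3) has_derivative (\<lambda>v. snd v $ 3)) (at p within S)"
    by (auto intro!: derivative_eq_intros bounded_linear.has_derivative[OF bounded_linear_vec_nth])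
  from has_derivative_divide[OF this rad_has_derivative[OF r] r]
  have *: "((\<lambda>q. snd q $ 3 / rad q) has_derivative
      (\<lambda>v. - (snd p $ 3) * (inverse (rad p) * d_r p v * inverse (rad p)) + snd v $ 3 / rad p)) (at p within S)" .
  have "(\<lambda>v. - (snd p $ 3) * (inverse (rad p) * d_r p v * inverse (rad p)) + snd v $ 3 / rad p)
      = (\<lambda>v. - sin (theta p) * d_th p v)"
  proof
    fix v
    have y: "snd p $ 3 = rad p * cos (theta p)" using cos_theta_eq[OF r] r by simp
    show "- (snd p $ 3) * (inverse (rad p) * d_r p v * inverse (rad p)) + snd v $ 3 / rad p
      = - sin (theta p) * d_th p v"
      unfolding y 3[of v] using r by (simp add: field_simps)
  qed
  with * have "((\<lambda>q. snd q $ 3 / rad q) has_derivative (\<lambda>v. - sin (theta p) * d_th p v)) (at p within S)" by simp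
  then show ?thesis
    by (rule has_derivative_transform[OF S(1) _, rotated]) (simp add: cos_theta_eq S(2))
qed

section \<open>The horizontal distribution and its one-forms\<close>

lemma frame_horizontal:
  assumes "M > 0" "\<bar>a\<bar> \<le> M" "p \<in> kerr_ext M a"
  shows "e1 a p \<in> hor M a p" "e2 a p \<in> hor M a p"
  using frame_products[OF assms] by (simp_all add: hor_def)

lemma horizontal_expansion:
  assumes k: "M > 0" "\<bar>a\<bar> \<le> M" "p \<in> kerr_ext M a" and v: "v \<in> hor M a p"
  shows "v = kerr_metric M a p v (e1 a p) *\<^sub>R e1 a p + kerr_metric M a p v (e2 a p) *\<^sub>R e2 a p"
proof -
  have r: "rad p \<noteq> 0" and S0: "kSigma a p \<noteq> 0" using kerr_ext_pos[OF k(1,3,2)] by auto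
  note fp = frame_products[OF k]
  note g1 = linear_add[OF metric_bilinear(2)] linear_scale[OF metric_bilinear(2)]
    linear_diff[OF metric_bilinear(2)]
  note cl = linear_add[OF covectors_linear(1)] linear_add[OF covectors_linear(2)]
    linear_add[OF covectors_linear(3)] linear_add[OF covectors_linear(4)]
    linear_diff[OF covectors_linear(1)] linear_diff[OF covectors_linear(2)]
    linear_diff[OF covectors_linear(3)] linear_diff[OF covectors_linear(4)]
    linear_scale[OF covectors_linear(1)] linear_scale[OF covectors_linear(2)]
    linear_scale[OF covectors_linear(3)] linear_scale[OF covectors_linear(4)]
  define h f c1 c2 where "h = d_th p v" and "f = d_phis p v"
    and "c1 = h * rad p + f * (a * cos (theta p))" and "c2 = f * rad p - h * (a * cos (theta p))"
  define S where "S = kSigma a p"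
  have S: "S = (rad p)\<^sup>2 + a\<^sup>2 * (cos (theta p))\<^sup>2" by (simp add: S_def kSigma_def)
  have t: "d_t p v = a * sin (theta p) * f"
    using v by (simp add: hor_def kerr_metric_def frame_coords[OF r] f_def)
  \<comment> \<open>The coefficients \<open>c1\<close>, \<open>c2\<close> make \<open>d_th\<close> and \<open>d_phis\<close> agree.  Orthogonality to \<open>e3\<close> is \<open>t\<close>, so that
      also \<open>d_t\<close> agrees and the difference \<open>w\<close> is a multiple of \<open>e3\<close>; orthogonality to \<open>e4\<close> removes
      that multiple.\<close>
  define w where "w = v - (c1 *\<^sub>R e1 a p + c2 *\<^sub>R e2 a p)"
  have "c1 * (a\<^sup>2 * sin (theta p) * cos (theta p)) + c2 * (a * rad p * sin (theta p)) = a * sin (theta p) * f * S"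
    "c1 * rad p - c2 * (a * cos (theta p)) = h * S" "c1 * (a * cos (theta p)) + c2 * rad p = f * S"
    unfolding c1_def c2_def S by algebra+
  then have "d_t p w = 0" "d_th p w = 0" "d_phis p w = 0"
    using S0 by (simp_all add: w_def cl frame_coords[OF r] t flip: S_def h_def f_def)
      (simp_all add: S_def field_simps)
  then have w: "w = - d_r p w *\<^sub>R e3 p"
    using covectors_separate[OF r, of "w - (- d_r p w *\<^sub>R e3 p)"] by (simp add: cl frame_coords[OF r] eq_neg_iff_add_eq_0)
  have "kerr_metric M a p w (e4 M a p) = 0"
    using v by (simp add: w_def g1 fp hor_def)
  then have "d_r p w = 0"
    using arg_cong[OF w, of "\<lambda>w. kerr_metric M a p w (e4 M a p)"]
    by (simp add: g1 linear_neg[OF metric_bilinear(2)] fp)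
  then have "v = c1 *\<^sub>R e1 a p + c2 *\<^sub>R e2 a p" using w by (simp add: w_def)
  moreover from this have "kerr_metric M a p v (e1 a p) = c1" "kerr_metric M a p v (e2 a p) = c2"
    using fp metric_sym[of M a p "e2 a p" "e1 a p"] by (simp_all add: g1)
  ultimately show ?thesis by simp
qed

lemma horizontal_linear_eqI:
  assumes "M > 0" "\<bar>a\<bar> \<le> M" "p \<in> kerr_ext M a" and v: "v \<in> hor M a p"
    and l: "linear f" "linear g" and "f (e1 a p) = g (e1 a p)" "f (e2 a p) = g (e2 a p)"
  shows "f v = (g v :: real)"
proof -
  obtain c1 c2 where v: "v = c1 *\<^sub>R e1 a p + c2 *\<^sub>R e2 a p" using horizontal_expansion[OF assms(1-4)] by blast
  show ?thesis
    unfolding v linear_add[OF l(1)] linear_add[OF l(2)] linear_scale[OF l(1)] linear_scale[OF l(2)] assms(7,8) ..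
qed

lemma hstar_eq:
  assumes "M > 0" "\<bar>a\<bar> \<le> M" "p \<in> kerr_ext M a"
  shows "hstar M a \<omega> p v = kerr_metric M a p v (e1 a p) * \<omega> p (e2 a p) - kerr_metric M a p v (e2 a p) * \<omega> p (e1 a p)"
  using frame_products[OF assms] metric_sym[of M a p "e2 a p" "e1 a p"] by (simp add: hstar_def area_def)

lemma hstar_frame:
  assumes "M > 0" "\<bar>a\<bar> \<le> M" "p \<in> kerr_ext M a"
  shows "hstar M a \<omega> p (e1 a p) = \<omega> p (e2 a p)" "hstar M a \<omega> p (e2 a p) = - \<omega> p (e1 a p)"
  using frame_products[OF assms] metric_sym[of M a p "e2 a p" "e1 a p"] by (simp_all add: hstar_eq[OF assms])

lemma linear_hstar:
  assumes "M > 0" "\<bar>a\<bar> \<le> M" "p \<in> kerr_ext M a"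
  shows "linear (hstar M a \<omega> p)"
  unfolding hstar_eq[OF assms]
  by (rule linearI)
    (simp_all add: linear_add[OF metric_bilinear(2)] linear_scale[OF metric_bilinear(2)] algebra_simps)

lemma linear_eta: "linear (eta a p)" "linear (etab a p)"
proof -
  have *: "linear (\<lambda>v. x * d_t p v - y * d_th p v + z * d_phis p v)" for x y z
    by (rule linearI)
      (simp_all add: covectors_linear[THEN linear_add] covectors_linear[THEN linear_scale] algebra_simps)
  show "linear (eta a p)" unfolding eta_def by (rule *)
  show "linear (etab a p)" unfolding etab_def using *[of _ _ "- z" for z] by (simp only: mult_minus_left add_uminus_conv_diff)
qed

text \<open>
  A horizontal one-form does not see the projection, so the first term of \<open>hD\<close> differentiates the
  smooth function \<open>\<alpha> q y\<close>, to which the product rule applies.  The second term is linear in the value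
  of the form at \<open>p\<close>, for any connection.
\<close>

lemma hD_scale:
  assumes p: "p \<in> kerr_ext M a" and \<alpha>: "smooth_form1 M a \<alpha>" "hform M a \<alpha>"
    and f: "(f has_derivative f') (at p within kerr_ext M a)"
  shows "hD M a (\<lambda>q v. f q * \<alpha> q v) p x y = f' x * \<alpha> p y + f p * hD M a \<alpha> p x y"
proof -
  have proj: "\<alpha> q (hproj M a q y) = \<alpha> q y" if "q \<in> kerr_ext M a" for q
    using \<alpha>(2) that by (simp add: hform_def hproj_def linear_add linear_scale)
  define A where "A = dird M a (\<lambda>q. \<alpha> q y) p"
  have A: "((\<lambda>q. \<alpha> q y) has_derivative A) (at p within kerr_ext M a)"
    unfolding A_def using \<alpha>(1) p by (intro smooth_fun_has_derivative) (simp add: smooth_form1_def del: split_paired_All)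
  have "((\<lambda>q. \<alpha> q (hproj M a q y)) has_derivative A) (at p within kerr_ext M a)"
    by (rule has_derivative_transform[OF p _ A]) (simp add: proj)
  note 1 = dird_eqI[OF p this]
  have "((\<lambda>q. f q * \<alpha> q (hproj M a q y)) has_derivative (\<lambda>v. f p * A v + f' v * \<alpha> p y))
      (at p within kerr_ext M a)"
    by (rule has_derivative_transform[OF p _ has_derivative_mult[OF f A]]) (simp add: proj)
  note 2 = dird_eqI[OF p this]
  show ?thesis by (simp add: hD_def hcov_def 1 2 algebra_simps)
qed

section \<open>The integrating factor\<close>

text \<open>Real and imaginary part of \<open>\<zeta>\<^sup>2 = (r + i a cos \<theta>)\<^sup>2\<close>.\<close>

definition zeta2_re :: "real \<Rightarrow> pt \<Rightarrow> real" where
  "zeta2_re a p = (rad p)\<^sup>2 - a\<^sup>2 * (cos (theta p))\<^sup>2"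

definition zeta2_im :: "real \<Rightarrow> pt \<Rightarrow> real" where
  "zeta2_im a p = 2 * a * rad p * cos (theta p)"

lemma chib_weights:
  assumes "kSigma a p \<noteq> 0"
  shows "1/4 * kSigma a p * ((tr_chib a p)\<^sup>2 - (eps_chib a p)\<^sup>2) = zeta2_re a p / kSigma a p"
    "1/4 * (kSigma a p)\<^sup>2 * ((tr_chib a p)\<^sup>2 - (eps_chib a p)\<^sup>2) = zeta2_re a p"
    "1/2 * kSigma a p * eps_chib a p * tr_chib a p = - (zeta2_im a p / kSigma a p)"
    "1/2 * (kSigma a p)\<^sup>2 * eps_chib a p * tr_chib a p = - zeta2_im a p"
  using assms
  by (simp_all add: tr_chib_def eps_chib_def zeta2_re_def zeta2_im_def power_divide power_mult_distrib
      field_simps power2_eq_square)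

text \<open>
  This is \<open>tr_chib + i eps_chib = - 2 / \<zeta>\<close> in real form: the equations are
  \<open>(tr_chib + i eps_chib) \<zeta>\<^sup>2 = - 2 \<zeta>\<close> and \<open>tr_chi - i eps_chi = - (\<Delta> / \<Sigma>) (tr_chib + i eps_chib)\<close>.
\<close>

lemma chi_zeta2:
  assumes "kSigma a p \<noteq> 0"
  shows "zeta2_re a p * tr_chib a p - zeta2_im a p * eps_chib a p = - 2 * rad p"
    "zeta2_im a p * tr_chib a p + zeta2_re a p * eps_chib a p = - 2 * a * cos (theta p)"
    "tr_chi M a p = - (kDelta M a p / kSigma a p) * tr_chib a p"
    "eps_chi M a p = kDelta M a p / kSigma a p * eps_chib a p"
proof -
  define S r c where "S = kSigma a p" and "r = rad p" and "c = cos (theta p)"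
  note abb = this[symmetric]
  have S: "S = r\<^sup>2 + a\<^sup>2 * c\<^sup>2" by (simp add: S_def r_def c_def kSigma_def)
  have S0: "S \<noteq> 0" using assms by (simp add: S_def)
  have "zeta2_re a p * tr_chib a p - zeta2_im a p * eps_chib a p
      = - (((r\<^sup>2 - a\<^sup>2 * c\<^sup>2) * (2 * r) + 2 * a * r * c * (2 * a * c)) / S)"
    by (simp add: zeta2_re_def zeta2_im_def tr_chib_def eps_chib_def abb add_divide_distrib)
  also have "(r\<^sup>2 - a\<^sup>2 * c\<^sup>2) * (2 * r) + 2 * a * r * c * (2 * a * c) = 2 * r * S"
    unfolding S by algebra
  finally show "zeta2_re a p * tr_chib a p - zeta2_im a p * eps_chib a p = - 2 * rad p"
    using S0 by (simp add: r_def)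
  have "zeta2_im a p * tr_chib a p + zeta2_re a p * eps_chib a p
      = (- (2 * a * r * c) * (2 * r) + (r\<^sup>2 - a\<^sup>2 * c\<^sup>2) * (2 * a * c)) / S"
    by (simp add: zeta2_re_def zeta2_im_def tr_chib_def eps_chib_def abb diff_divide_distrib)
  also have "- (2 * a * r * c) * (2 * r) + (r\<^sup>2 - a\<^sup>2 * c\<^sup>2) * (2 * a * c) = - (2 * a * c) * S"
    unfolding S by algebra
  finally show "zeta2_im a p * tr_chib a p + zeta2_re a p * eps_chib a p = - 2 * a * cos (theta p)"
    using S0 by (simp add: c_def)
  show "tr_chi M a p = - (kDelta M a p / kSigma a p) * tr_chib a p"
    "eps_chi M a p = kDelta M a p / kSigma a p * eps_chib a p"
    by (simp_all add: tr_chi_def tr_chib_def eps_chi_def eps_chib_def power2_eq_square)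
qed

lemma hat_eq:
  assumes "kSigma a p \<noteq> 0"
  shows "rho_hat a \<rho> \<sigma> p = zeta2_re a p * \<rho> p - zeta2_im a p * \<sigma> p"
    "sigma_hat a \<rho> \<sigma> p = zeta2_im a p * \<rho> p + zeta2_re a p * \<sigma> p"
  using assms unfolding rho_hat_def sigma_hat_def chib_weights[OF assms] by simp_all

lemma weights_have_derivative:
  assumes k: "M > 0" "\<bar>a\<bar> \<le> M" "p \<in> kerr_ext M a"
  shows "(zeta2_re a has_derivative (\<lambda>v. 2 * rad p * d_r p v + 2 * a\<^sup>2 * cos (theta p) * sin (theta p) * d_th p v))
      (at p within kerr_ext M a)"
    "(zeta2_im a has_derivative (\<lambda>v. 2 * a * (cos (theta p) * d_r p v - rad p * sin (theta p) * d_th p v)))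
      (at p within kerr_ext M a)"
    "(kSigma a has_derivative (\<lambda>v. 2 * rad p * d_r p v - 2 * a\<^sup>2 * cos (theta p) * sin (theta p) * d_th p v))
      (at p within kerr_ext M a)"
proof -
  have pos: "rad q \<noteq> 0" if "q \<in> kerr_ext M a" for q using kerr_ext_pos(1)[OF k(1) that k(2)] by simp
  note d [derivative_intros] = rad_has_derivative[OF pos[OF k(3)]] cos_theta_has_derivative[OF pos[OF k(3)] k(3) pos]
  show "(zeta2_re a has_derivative (\<lambda>v. 2 * rad p * d_r p v + 2 * a\<^sup>2 * cos (theta p) * sin (theta p) * d_th p v))
      (at p within kerr_ext M a)"
    unfolding zeta2_re_def[abs_def] by (rule derivative_eq_intros d refl | simp add: algebra_simps)+
  show "(zeta2_im a has_derivative (\<lambda>v. 2 * a * (cos (theta p) * d_r p v - rad p * sin (theta p) * d_th p v)))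
      (at p within kerr_ext M a)"
    unfolding zeta2_im_def[abs_def] by (rule derivative_eq_intros d refl | simp add: algebra_simps)+
  show "(kSigma a has_derivative (\<lambda>v. 2 * rad p * d_r p v - 2 * a\<^sup>2 * cos (theta p) * sin (theta p) * d_th p v))
      (at p within kerr_ext M a)"
    unfolding kSigma_def[abs_def] by (rule derivative_eq_intros d refl | simp add: algebra_simps)+
qed

text \<open>
  The left-hand sides are the derivatives of \<open>\<Sigma>\<close> and of the real and imaginary part of \<open>\<zeta>\<^sup>2\<close>, and the
  last two equations are \<open>d(\<zeta>\<^sup>2) = \<zeta>\<^sup>2 ((\<eta> + etab) - i star(\<eta> - etab))\<close>.  They hold because \<open>\<eta> + etab\<close> only
  has a \<open>\<theta>\<close>-component, while \<open>\<eta> - etab\<close> is a multiple of \<open>(r\<^sup>2 + a\<^sup>2) d\<phi> - a dt\<close>, whose values on the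
  frame collapse by \<open>r\<^sup>2 + a\<^sup>2 - a\<^sup>2 sin\<^sup>2 \<theta> = \<Sigma>\<close>.
\<close>

lemma weights_frame_derivatives:
  fixes M a p
  assumes k: "M > 0" "\<bar>a\<bar> \<le> M" "p \<in> kerr_ext M a" and x: "x = e1 a p \<or> x = e2 a p"
  defines "s \<equiv> \<lambda>v. eta a p v + etab a p v"
    and "d \<equiv> hstar M a (\<lambda>q v. eta a q v - etab a q v) p"
  shows "2 * rad p * d_r p x - 2 * a\<^sup>2 * cos (theta p) * sin (theta p) * d_th p x = kSigma a p * s x"
    "2 * rad p * d_r p x + 2 * a\<^sup>2 * cos (theta p) * sin (theta p) * d_th p x
       = zeta2_re a p * s x + zeta2_im a p * d x"
    "2 * a * (cos (theta p) * d_r p x - rad p * sin (theta p) * d_th p x)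
       = zeta2_im a p * s x - zeta2_re a p * d x"
proof -
  have r: "rad p \<noteq> 0" and S0: "kSigma a p \<noteq> 0" using kerr_ext_pos[OF k(1,3,2)] by auto
  define S r c u where "S = kSigma a p" and "r = rad p" and "c = cos (theta p)" and "u = sin (theta p)"
  note abb = this[symmetric]
  have S: "S = r\<^sup>2 + a\<^sup>2 * c\<^sup>2" and u: "u\<^sup>2 = 1 - c\<^sup>2" and S0: "S \<noteq> 0"
    using S0 by (simp_all add: S_def r_def c_def u_def kSigma_def sin_squared_eq)
  have s: "s v = - (2 * a\<^sup>2 * u * c / S) * d_th p v" for v
    unfolding s_def eta_def etab_def sin_double abb using S0 by (simp add: field_simps)
  have h: "eta a p v - etab a p v = 2 * a * r * u * ((r\<^sup>2 + a\<^sup>2) * d_phis p v - a * u * d_t p v) / S\<^sup>2" for v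
    using S0 by (simp add: eta_def etab_def abb field_simps power2_eq_square)
  have X: "r\<^sup>2 + a\<^sup>2 = S + a\<^sup>2 * u\<^sup>2" unfolding S u by (simp add: algebra_simps)
  have h12: "eta a p (e1 a p) - etab a p (e1 a p) = 2 * a\<^sup>2 * r * u * c / S\<^sup>2"
    "eta a p (e2 a p) - etab a p (e2 a p) = 2 * a * r\<^sup>2 * u / S\<^sup>2"
    unfolding h X frame_coords[OF r] abb using S0 by (simp_all add: field_simps power2_eq_square)
  note unf = s frame_coords[OF r] zeta2_re_def zeta2_im_def d_def hstar_frame[OF k] h12 abb
  show "2 * rad p * d_r p x - 2 * a\<^sup>2 * cos (theta p) * sin (theta p) * d_th p x = kSigma a p * s x"
    using x S0 by (auto simp: unf)
  obtain i where i: "inverse S = i" "S * i = 1" using S0 by simp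
  note unf' = divide_inverse power_inverse[symmetric] i(1)
  \<comment> \<open>The two equations on \<open>e1\<close> and on \<open>e2\<close>, with the values on the frame inserted (\<open>0\<close> is \<open>d_r\<close>)
      and \<open>i\<close> for \<open>1 / \<Sigma>\<close>: polynomial identities modulo \<open>(r\<^sup>2 + a\<^sup>2 c\<^sup>2) i = 1\<close>.\<close>
  have "2 * r * 0 + 2 * a\<^sup>2 * c * u * (r * i)
      = (r\<^sup>2 - a\<^sup>2 * c\<^sup>2) * (- (2 * a\<^sup>2 * u * c * i) * (r * i)) + 2 * a * r * c * (2 * a * r\<^sup>2 * u * i\<^sup>2)"
    "2 * r * 0 + 2 * a\<^sup>2 * c * u * - (a * c * i)
      = (r\<^sup>2 - a\<^sup>2 * c\<^sup>2) * (- (2 * a\<^sup>2 * u * c * i) * - (a * c * i)) + 2 * a * r * c * - (2 * a\<^sup>2 * r * u * c * i\<^sup>2)"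
    "2 * a * (c * 0 - r * u * (r * i))
      = 2 * a * r * c * (- (2 * a\<^sup>2 * u * c * i) * (r * i)) - (r\<^sup>2 - a\<^sup>2 * c\<^sup>2) * (2 * a * r\<^sup>2 * u * i\<^sup>2)"
    "2 * a * (c * 0 - r * u * - (a * c * i))
      = 2 * a * r * c * (- (2 * a\<^sup>2 * u * c * i) * - (a * c * i)) - (r\<^sup>2 - a\<^sup>2 * c\<^sup>2) * - (2 * a\<^sup>2 * r * u * c * i\<^sup>2)"
    using S i(2) by algebra+
  then show "2 * rad p * d_r p x + 2 * a\<^sup>2 * cos (theta p) * sin (theta p) * d_th p x
       = zeta2_re a p * s x + zeta2_im a p * d x"
    "2 * a * (cos (theta p) * d_r p x - rad p * sin (theta p) * d_th p x)
       = zeta2_im a p * s x - zeta2_re a p * d x"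
    using x by (elim disjE; simp only: unf unf')+
qed

lemma div_curl_kSigma:
  assumes k: "M > 0" "\<bar>a\<bar> \<le> M" "p \<in> kerr_ext M a" and \<alpha>: "smooth_form1 M a \<alpha>" "hform M a \<alpha>"
  shows "hdiv M a (\<lambda>q v. kSigma a q * \<alpha> q v) p
      = kSigma a p * (hdiv M a \<alpha> p + hinner a (\<lambda>q v. eta a q v + etab a q v) \<alpha> p)"
    "hcurl M a (\<lambda>q v. kSigma a q * \<alpha> q v) p
      = kSigma a p * (hcurl M a \<alpha> p + hwedge a (\<lambda>q v. eta a q v + etab a q v) \<alpha> p)"
proof -
  let ?D = "\<lambda>x y. hD M a (\<lambda>q v. kSigma a q * \<alpha> q v) p x y"
  have "?D x y = kSigma a p * ((eta a p x + etab a p x) * \<alpha> p y + hD M a \<alpha> p x y)"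
    if "x = e1 a p \<or> x = e2 a p" for x y
    unfolding hD_scale[OF k(3) \<alpha> weights_have_derivative(3)[OF k]] weights_frame_derivatives(1)[OF k that]
    by (simp add: distrib_left)
  note D = this[OF disjI1[OF refl]] this[OF disjI2[OF refl]]
  show "hdiv M a (\<lambda>q v. kSigma a q * \<alpha> q v) p
      = kSigma a p * (hdiv M a \<alpha> p + hinner a (\<lambda>q v. eta a q v + etab a q v) \<alpha> p)"
    unfolding hdiv_def hinner_def D by (simp add: algebra_simps)
  show "hcurl M a (\<lambda>q v. kSigma a q * \<alpha> q v) p
      = kSigma a p * (hcurl M a \<alpha> p + hwedge a (\<lambda>q v. eta a q v + etab a q v) \<alpha> p)"
    unfolding hcurl_def hwedge_def D by (simp add: algebra_simps)
qed

lemma dird_hat: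
  assumes k: "M > 0" "\<bar>a\<bar> \<le> M" "p \<in> kerr_ext M a" and s: "smooth_fun M a \<rho>" "smooth_fun M a \<sigma>"
  defines "d_re \<equiv> \<lambda>v. 2 * rad p * d_r p v + 2 * a\<^sup>2 * cos (theta p) * sin (theta p) * d_th p v"
    and "d_im \<equiv> \<lambda>v. 2 * a * (cos (theta p) * d_r p v - rad p * sin (theta p) * d_th p v)"
  shows "dird M a (rho_hat a \<rho> \<sigma>) p v = zeta2_re a p * dird M a \<rho> p v + d_re v * \<rho> p
        - (zeta2_im a p * dird M a \<sigma> p v + d_im v * \<sigma> p)"
    "dird M a (sigma_hat a \<rho> \<sigma>) p v = zeta2_im a p * dird M a \<rho> p v + d_im v * \<rho> p
        + (zeta2_re a p * dird M a \<sigma> p v + d_re v * \<sigma> p)"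
proof -
  note w = weights_have_derivative[OF k, folded d_re_def d_im_def]
  note r = smooth_fun_has_derivative[OF s(1) k(3)] and g = smooth_fun_has_derivative[OF s(2) k(3)]
  have eq: "rho_hat a \<rho> \<sigma> q = zeta2_re a q * \<rho> q - zeta2_im a q * \<sigma> q"
    "sigma_hat a \<rho> \<sigma> q = zeta2_im a q * \<rho> q + zeta2_re a q * \<sigma> q" if "q \<in> kerr_ext M a" for q
    using kerr_ext_pos(2)[OF k(1) that k(2)] by (auto intro!: hat_eq)
  note 1 = has_derivative_transform[OF k(3) eq(1)
      has_derivative_diff[OF has_derivative_mult[OF w(1) r] has_derivative_mult[OF w(2) g]]]
  note 2 = has_derivative_transform[OF k(3) eq(2)
      has_derivative_add[OF has_derivative_mult[OF w(2) r] has_derivative_mult[OF w(1) g]]]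
  show "dird M a (rho_hat a \<rho> \<sigma>) p v = zeta2_re a p * dird M a \<rho> p v + d_re v * \<rho> p
        - (zeta2_im a p * dird M a \<sigma> p v + d_im v * \<sigma> p)"
    by (subst dird_eqI[OF k(3) 1]) simp_all
  show "dird M a (sigma_hat a \<rho> \<sigma>) p v = zeta2_im a p * dird M a \<rho> p v + d_im v * \<rho> p
        + (zeta2_re a p * dird M a \<sigma> p v + d_re v * \<sigma> p)"
    by (subst dird_eqI[OF k(3) 2]) simp_all
qed

section \<open>The transformed Maxwell equations\<close>

text \<open>
  Both null directions satisfy \<open>x(\<zeta>) = E\<close> with \<open>E\<close> real, and along both the Maxwell equations read
  \<open>x(\<Phi>) = dv - i cu - (2 E / \<zeta>) \<Phi>\<close>, so that multiplication with \<open>\<zeta>\<^sup>2\<close> removes the last term.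
\<close>

lemma null_derivative_hat:
  assumes k: "M > 0" "\<bar>a\<bar> \<le> M" "p \<in> kerr_ext M a" and s: "smooth_fun M a \<rho>" "smooth_fun M a \<sigma>"
    and x: "d_r p x = E" "d_th p x = 0"
    and m: "dird M a \<rho> p x = dv + E * (tr_chib a p * \<rho> p - eps_chib a p * \<sigma> p)"
      "dird M a \<sigma> p x = - cu + E * (eps_chib a p * \<rho> p + tr_chib a p * \<sigma> p)"
  shows "dird M a (rho_hat a \<rho> \<sigma>) p x = zeta2_re a p * dv + zeta2_im a p * cu"
    "dird M a (sigma_hat a \<rho> \<sigma>) p x = zeta2_im a p * dv - zeta2_re a p * cu"
proof -
  have S0: "kSigma a p \<noteq> 0" using kerr_ext_pos[OF k(1,3,2)] by auto
  have w: "2 * rad p = zeta2_im a p * eps_chib a p - zeta2_re a p * tr_chib a p"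
    "2 * a * cos (theta p) = - (zeta2_im a p * tr_chib a p + zeta2_re a p * eps_chib a p)"
    using chi_zeta2(1,2)[OF S0] by simp_all
  have d: "2 * a * (cos (theta p) * E) = 2 * a * cos (theta p) * E" by simp
  show "dird M a (rho_hat a \<rho> \<sigma>) p x = zeta2_re a p * dv + zeta2_im a p * cu"
    "dird M a (sigma_hat a \<rho> \<sigma>) p x = zeta2_im a p * dv - zeta2_re a p * cu"
    unfolding dird_hat[OF k s] m x mult_zero_right add_0_right diff_0_right d w
    by (simp_all add: algebra_simps)
qed

lemma null_derivatives_hat:
  assumes k: "M > 0" "\<bar>a\<bar> \<le> M" and sol: "smooth_maxwell_solution M a \<alpha> \<alpha>b \<rho> \<sigma>" and p: "p \<in> kerr_ext M a"
  shows "D3s M a (sigma_hat a \<rho> \<sigma>) p = - zeta2_im a p * hdiv M a \<alpha>b p - zeta2_re a p * hcurl M a \<alpha>b p"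
    "D3s M a (rho_hat a \<rho> \<sigma>) p = - zeta2_re a p * hdiv M a \<alpha>b p + zeta2_im a p * hcurl M a \<alpha>b p"
    "D4s M a (sigma_hat a \<rho> \<sigma>) p =
       zeta2_im a p * (hdiv M a \<alpha> p + hinner a (\<lambda>q v. eta a q v + etab a q v) \<alpha> p)
       - zeta2_re a p * (hcurl M a \<alpha> p + hwedge a (\<lambda>q v. eta a q v + etab a q v) \<alpha> p)"
    "D4s M a (rho_hat a \<rho> \<sigma>) p =
       zeta2_re a p * (hdiv M a \<alpha> p + hinner a (\<lambda>q v. eta a q v + etab a q v) \<alpha> p)
       + zeta2_im a p * (hcurl M a \<alpha> p + hwedge a (\<lambda>q v. eta a q v + etab a q v) \<alpha> p)"
proof -
  have r: "rad p \<noteq> 0" and S0: "kSigma a p \<noteq> 0" using kerr_ext_pos[OF k(1) p k(2)] by auto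
  have s: "smooth_fun M a \<rho>" "smooth_fun M a \<sigma>" using sol by (simp_all add: smooth_maxwell_solution_def)
  have mx: "maxwell M a \<alpha> \<alpha>b \<rho> \<sigma>" using sol by (simp add: smooth_maxwell_solution_def)
  have m: "D3s M a \<sigma> p + tr_chib a p * \<sigma> p = - hcurl M a \<alpha>b p - eps_chib a p * \<rho> p"
    "D3s M a \<rho> p + tr_chib a p * \<rho> p = - hdiv M a \<alpha>b p + eps_chib a p * \<sigma> p"
    "D4s M a \<sigma> p + tr_chi M a p * \<sigma> p =
       - hcurl M a \<alpha> p - hwedge a (\<lambda>q v. eta a q v + etab a q v) \<alpha> p + eps_chi M a p * \<rho> p"
    "D4s M a \<rho> p + tr_chi M a p * \<rho> p =
       hdiv M a \<alpha> p + hinner a (\<lambda>q v. eta a q v + etab a q v) \<alpha> p - eps_chi M a p * \<sigma> p"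
    using mx[unfolded maxwell_def, rule_format, OF p] by blast+
  have "dird M a \<rho> p (e3 p) = - hdiv M a \<alpha>b p + - 1 * (tr_chib a p * \<rho> p - eps_chib a p * \<sigma> p)"
    "dird M a \<sigma> p (e3 p) = - hcurl M a \<alpha>b p + - 1 * (eps_chib a p * \<rho> p + tr_chib a p * \<sigma> p)"
    using m(1,2) unfolding D3s_def by (simp_all add: algebra_simps)
  from null_derivative_hat[OF k p s frame_coords(2,3)[OF r] this]
  show "D3s M a (sigma_hat a \<rho> \<sigma>) p = - zeta2_im a p * hdiv M a \<alpha>b p - zeta2_re a p * hcurl M a \<alpha>b p"
    "D3s M a (rho_hat a \<rho> \<sigma>) p = - zeta2_re a p * hdiv M a \<alpha>b p + zeta2_im a p * hcurl M a \<alpha>b p"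
    unfolding D3s_def by simp_all
  have "dird M a \<rho> p (e4 M a p) = (hdiv M a \<alpha> p + hinner a (\<lambda>q v. eta a q v + etab a q v) \<alpha> p)
      + kDelta M a p / kSigma a p * (tr_chib a p * \<rho> p - eps_chib a p * \<sigma> p)"
    "dird M a \<sigma> p (e4 M a p) = - (hcurl M a \<alpha> p + hwedge a (\<lambda>q v. eta a q v + etab a q v) \<alpha> p)
      + kDelta M a p / kSigma a p * (eps_chib a p * \<rho> p + tr_chib a p * \<sigma> p)"
    using m(3,4) unfolding D4s_def chi_zeta2(3,4)[OF S0] distrib_left right_diff_distrib
      mult_minus_left mult.assoc by (simp_all add: algebra_simps)
  from null_derivative_hat[OF k p s frame_coords(6,7)[OF r] this]
  show "D4s M a (sigma_hat a \<rho> \<sigma>) p =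
       zeta2_im a p * (hdiv M a \<alpha> p + hinner a (\<lambda>q v. eta a q v + etab a q v) \<alpha> p)
       - zeta2_re a p * (hcurl M a \<alpha> p + hwedge a (\<lambda>q v. eta a q v + etab a q v) \<alpha> p)"
    "D4s M a (rho_hat a \<rho> \<sigma>) p =
       zeta2_re a p * (hdiv M a \<alpha> p + hinner a (\<lambda>q v. eta a q v + etab a q v) \<alpha> p)
       + zeta2_im a p * (hcurl M a \<alpha> p + hwedge a (\<lambda>q v. eta a q v + etab a q v) \<alpha> p)"
    unfolding D4s_def by simp_all
qed

text \<open>
  With \<open>d(\<zeta>\<^sup>2) = \<zeta>\<^sup>2 (s - i h)\<close>, where \<open>s = \<eta> + etab\<close> and \<open>h = star(\<eta> - etab)\<close>, the sum and the difference of the two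
  tensorial Maxwell equations give \<open>X - i Y = \<Sigma> (d\<Phi> + (s - i h) \<Phi>)\<close>.
\<close>

lemma horizontal_gradients_hat:
  fixes M a p \<alpha> \<alpha>b
  assumes k: "M > 0" "\<bar>a\<bar> \<le> M" and sol: "smooth_maxwell_solution M a \<alpha> \<alpha>b \<rho> \<sigma>" and p: "p \<in> kerr_ext M a"
    and v: "v \<in> hor M a p"
  defines "X \<equiv> \<lambda>v. frakT M a \<alpha> p v - frakTb M a \<alpha>b p v"
    and "Y \<equiv> \<lambda>v. hstar M a (frakT M a \<alpha>) p v + hstar M a (frakTb M a \<alpha>b) p v"
  shows "hgrad M a (sigma_hat a \<rho> \<sigma>) p v = zeta2_im a p / kSigma a p * X v - zeta2_re a p / kSigma a p * Y v"
    "hgrad M a (rho_hat a \<rho> \<sigma>) p v = zeta2_re a p / kSigma a p * X v + zeta2_im a p / kSigma a p * Y v"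
proof -
  note k = k p
  have S0: "kSigma a p \<noteq> 0" using kerr_ext_pos[OF k(1,3,2)] by auto
  have s: "smooth_fun M a \<rho>" "smooth_fun M a \<sigma>" using sol by (simp_all add: smooth_maxwell_solution_def)
  have grad: "hgrad M a u p x = dird M a u p x" if "x \<in> hor M a p" for u x
    using that hproj_orthogonal(2)[OF k] by (simp add: hgrad_def)
  have lin: "linear (dird M a \<rho> p)" "linear (dird M a \<sigma> p)"
    using s by (auto intro!: has_derivative_linear[OF smooth_fun_has_derivative] p)
  define h where "h = (\<lambda>q v. eta a q v - etab a q v)"
  define S where "S = kSigma a p"
  note S0 = S0[folded S_def]
  note fr = frame_horizontal[OF k] and st = hstar_frame[OF k]
  have hdiff: "hstar M a (eta a) p x - hstar M a (etab a) p x = hstar M a h p x" for x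
    by (simp add: hstar_eq[OF k] h_def algebra_simps)
  have T: "frakT M a \<alpha> p x = 1/2 * S * (hgrad M a \<rho> p x + hstar M a (hgrad M a \<sigma>) p x
          + 2 * eta a p x * \<rho> p + 2 * hstar M a (eta a) p x * \<sigma> p)"
    "frakTb M a \<alpha>b p x = 1/2 * S * (- hgrad M a \<rho> p x + hstar M a (hgrad M a \<sigma>) p x
          - 2 * etab a p x * \<rho> p + 2 * hstar M a (etab a) p x * \<sigma> p)" if "x \<in> hor M a p" for x
    using sol p that unfolding frakT_def frakTb_def smooth_maxwell_solution_def maxwell_def S_def by auto
  have X: "X x = S * (dird M a \<rho> p x + (eta a p x + etab a p x) * \<rho> p + hstar M a h p x * \<sigma> p)"
    if "x \<in> hor M a p" for x
    unfolding X_def T[OF that] grad[OF that] hdiff[symmetric] by (simp add: algebra_simps)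
  \<comment> \<open>In \<open>Y\<close> the star is applied to the star of \<open>d\<sigma>\<close>, which gives \<open>- d\<sigma>\<close>.\<close>
  have Y_lin: "linear Y" unfolding Y_def by (intro linear_compose_add linear_hstar[OF k])
  define Z where "Z = (\<lambda>x. S * (- dird M a \<sigma> p x + hstar M a h p x * \<rho> p - (eta a p x + etab a p x) * \<sigma> p))"
  have Z_lin: "linear Z"
    unfolding Z_def
    by (rule linearI) (simp_all add: lin[THEN linear_add] lin[THEN linear_scale]
        linear_add[OF linear_hstar[OF k]] linear_scale[OF linear_hstar[OF k]]
        linear_eta[THEN linear_add] linear_eta[THEN linear_scale] algebra_simps)
  have Y: "Y v = Z v"
    by (rule horizontal_linear_eqI[OF k v Y_lin Z_lin])
      (simp_all add: Y_def Z_def st T fr grad h_def algebra_simps)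
  note wd = has_derivative_linear[OF weights_have_derivative(1)[OF k]]
    has_derivative_linear[OF weights_have_derivative(2)[OF k]]
  note wf = weights_frame_derivatives(2,3)[OF k]
  have lr: "linear (\<lambda>x. A * (eta a p x + etab a p x) + B * hstar M a h p x)" for A B
    by (rule linearI) (simp_all add: 
        linear_add[OF linear_hstar[OF k]] linear_scale[OF linear_hstar[OF k]]
        linear_eta[THEN linear_add] linear_eta[THEN linear_scale] algebra_simps)
  have re: "2 * rad p * d_r p v + 2 * a\<^sup>2 * cos (theta p) * sin (theta p) * d_th p v
      = zeta2_re a p * (eta a p v + etab a p v) + zeta2_im a p * hstar M a h p v"
    by (rule horizontal_linear_eqI[OF k v wd(1) lr]) (simp_all only: wf h_def simp_thms)
  have im: "2 * a * (cos (theta p) * d_r p v - rad p * sin (theta p) * d_th p v)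
      = zeta2_im a p * (eta a p v + etab a p v) + (- zeta2_re a p) * hstar M a h p v"
    by (rule horizontal_linear_eqI[OF k v wd(2) lr]) (simp_all only: wf h_def simp_thms mult_minus_left add_uminus_conv_diff)
  note dh = dird_hat[OF k s, of v]
  show "hgrad M a (sigma_hat a \<rho> \<sigma>) p v = zeta2_im a p / kSigma a p * X v - zeta2_re a p / kSigma a p * Y v"
    "hgrad M a (rho_hat a \<rho> \<sigma>) p v = zeta2_re a p / kSigma a p * X v + zeta2_im a p / kSigma a p * Y v"
    unfolding grad[OF v] dh re im Y X[OF v] Z_def S_def[symmetric] using S0
    by (simp_all add: algebra_simps)
qed

theorem proposition3p3:
  fixes M a :: real
    and \<alpha> \<alpha>b :: "pt \<Rightarrow> pt \<Rightarrow> real"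
    and \<rho> \<sigma> :: "pt \<Rightarrow> real"
  assumes "M > 0"
    and "\<bar>a\<bar> \<le> M"
    and "smooth_maxwell_solution M a \<alpha> \<alpha>b \<rho> \<sigma>"
  shows "\<forall>p\<in>kerr_ext M a.
       (rho_hat a \<rho> \<sigma> p = ((rad p)\<^sup>2 - a\<^sup>2 * (cos (theta p))\<^sup>2) * \<rho> p - 2 * a * rad p * cos (theta p) * \<sigma> p) \<and>
       (sigma_hat a \<rho> \<sigma> p = 2 * a * rad p * cos (theta p) * \<rho> p + ((rad p)\<^sup>2 - a\<^sup>2 * (cos (theta p))\<^sup>2) * \<sigma> p) \<and>
       (D3s M a (sigma_hat a \<rho> \<sigma>) p =
         1/2 * (kSigma a p)\<^sup>2 * eps_chib a p * tr_chib a p * hdiv M a \<alpha>b p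
         - 1/4 * (kSigma a p)\<^sup>2 * ((tr_chib a p)\<^sup>2 - (eps_chib a p)\<^sup>2) * hcurl M a \<alpha>b p) \<and>
       (D3s M a (rho_hat a \<rho> \<sigma>) p =
         - (1/4 * (kSigma a p)\<^sup>2 * ((tr_chib a p)\<^sup>2 - (eps_chib a p)\<^sup>2) * hdiv M a \<alpha>b p)
         - 1/2 * (kSigma a p)\<^sup>2 * eps_chib a p * tr_chib a p * hcurl M a \<alpha>b p) \<and>
       (D4s M a (sigma_hat a \<rho> \<sigma>) p =
         - (1/2 * kSigma a p * eps_chib a p * tr_chib a p * hdiv M a (\<lambda>q v. kSigma a q * \<alpha> q v) p)
         - 1/4 * kSigma a p * ((tr_chib a p)\<^sup>2 - (eps_chib a p)\<^sup>2)
             * hcurl M a (\<lambda>q v. kSigma a q * \<alpha> q v) p) \<and>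
       (D4s M a (rho_hat a \<rho> \<sigma>) p =
         1/4 * kSigma a p * ((tr_chib a p)\<^sup>2 - (eps_chib a p)\<^sup>2) * hdiv M a (\<lambda>q v. kSigma a q * \<alpha> q v) p
         - 1/2 * kSigma a p * eps_chib a p * tr_chib a p * hcurl M a (\<lambda>q v. kSigma a q * \<alpha> q v) p) \<and>
       (\<forall>v\<in>hor M a p.
       hgrad M a (sigma_hat a \<rho> \<sigma>) p v =
         - (1/2 * kSigma a p * eps_chib a p * tr_chib a p * (frakT M a \<alpha> p v - frakTb M a \<alpha>b p v))
         - 1/4 * kSigma a p * ((tr_chib a p)\<^sup>2 - (eps_chib a p)\<^sup>2)
             * (hstar M a (frakT M a \<alpha>) p v + hstar M a (frakTb M a \<alpha>b) p v)) \<and>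
       (\<forall>v\<in>hor M a p.
       hgrad M a (rho_hat a \<rho> \<sigma>) p v =
         1/4 * kSigma a p * ((tr_chib a p)\<^sup>2 - (eps_chib a p)\<^sup>2) * (frakT M a \<alpha> p v - frakTb M a \<alpha>b p v)
         - 1/2 * kSigma a p * eps_chib a p * tr_chib a p
             * (hstar M a (frakT M a \<alpha>) p v + hstar M a (frakTb M a \<alpha>b) p v))"
proof (rule ballI, goal_cases)
  case (1 p)
  note k = assms(1,2) 1
  have S0: "kSigma a p \<noteq> 0" using kerr_ext_pos[OF k(1,3,2)] by auto
  have \<alpha>: "smooth_form1 M a \<alpha>" "hform M a \<alpha>" using assms(3) by (simp_all add: smooth_maxwell_solution_def)
  have cancel: "x / kSigma a p * (kSigma a p * y) = x * y" for x y using S0 by simp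
  note hats = hat_eq[OF S0, of \<rho> \<sigma>, unfolded zeta2_re_def zeta2_im_def]
  show ?case
    unfolding chib_weights[OF S0] null_derivatives_hat[OF assms 1] div_curl_kSigma[OF k \<alpha>] mult_minus_left minus_minus cancel
    by (intro conjI ballI) (simp_all only: hats horizontal_gradients_hat[OF assms 1] mult_minus_left
        minus_minus diff_minus_eq_add add_uminus_conv_diff)
qed

end
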